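(* Let $\phi$ be a Ma-Minda function such that $\min_{|z|=r}|\phi(z)|=\phi(-r)$ and $\max_{|z|=r}|\phi(z)|=\phi(r)$ for all $0<r<1$. Let $k$ be the analytic function in $\mathbb{D}$ with $1+zk''(z)/k'(z)=\phi(z)$, $k(0)=k'(0)-1=0$, and let $K'(z)=\left(k'(z^2)\right)^{1/2}$ (branch with $K'(0)=1$). Put $$R_s(r):=\int_0^r\frac1s\int_0^sM_{K'}(t)M_\phi(t)\,dt\,ds,\qquad L_s(r):=\int_0^r\frac1s\int_0^s\left(k'(-t^2)\right)^{1/2}\phi(-t)\,dt\,ds ,$$ where $M_{K'}$ and $M_\phi$ are the majorant series of $K'$ and $\phi$. Let $f(z)=z+\sum_{n=2}^\infty a_nz^n\in\mathcal{C}_s(\phi)$. Then $$|z|+\sum_{n=2}^\infty|a_n||z|^n\le d(f(0),\partial f(\mathbb{D}))$$ for $|z|=r\le\min\{1/3,r_f\}$, where $r_f$ is the smallest positive root of $R_s(r)=L_s(1)$ in $(0,1)$.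
   Context: $\mathbb{D}=\{z\in\mathbb{C}:|z|<1\}$ and $\mathcal{A}$ is the class of analytic functions $f$ in $\mathbb{D}$ of the form $f(z)=z+\sum_{n\ge2}a_nz^n$. $d$ is Euclidean distance, $d(f(0),\partial f(\mathbb{D}))$ being the distance from $f(0)$ to the boundary of $f(\mathbb{D})$. For $f(z)=\sum_{n\ge0}a_nz^n$ analytic in $\mathbb{D}$, the majorant series is $M_f(r)=\sum_{n\ge0}|a_n|r^n$, $0\le r<1$. For analytic $f,g$ in $\mathbb{D}$, $f\prec g$ means $f=g\circ\omega$ for some analytic $\omega:\mathbb{D}\to\mathbb{D}$ with $\omega(0)=0$. A Ma-Minda function is an analytic univalent function $\phi:\mathbb{D}\to\mathbb{C}$ such that $\phi(\mathbb{D})$ lies in the right half-plane $\{\mathrm{Re}\,w>0\}$, is symmetric with respect to the real axis and starlike with respect to $\phi(0)=1$, and $\phi'(0)>0$. $\mathcal{C}_s(\phi)$ is the class of $f\in\mathcal{A}$ with $\dfrac{2(zf'(z))'}{f'(z)+f'(-z)}\prec\phi(z)$ in $\mathbb{D}$. *)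

theory Defs
  imports "HOL-Complex_Analysis.Complex_Analysis"
begin

abbreviation unit_disc :: "complex set" where
  "unit_disc \<equiv> ball 0 1"

definition class_A :: "(complex \<Rightarrow> complex) set" where
  "class_A = {f. f holomorphic_on unit_disc \<and> f 0 = 0 \<and> deriv f 0 = 1}"

abbreviation taylor_coeff :: "(complex \<Rightarrow> complex) \<Rightarrow> nat \<Rightarrow> complex" where
  "taylor_coeff f n \<equiv> fps_nth (fps_expansion f 0) n"

definition majorant :: "(complex \<Rightarrow> complex) \<Rightarrow> real \<Rightarrow> real" where
  "majorant f r = (\<Sum>n. cmod (taylor_coeff f n) * r ^ n)"

definition subordinate :: "(complex \<Rightarrow> complex) \<Rightarrow> (complex \<Rightarrow> complex) \<Rightarrow> bool"
    (infix "\<prec>" 50) where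
  "f \<prec> g \<longleftrightarrow> (\<exists>\<omega>. \<omega> holomorphic_on unit_disc \<and> \<omega> ` unit_disc \<subseteq> unit_disc \<and> \<omega> 0 = 0 \<and>
                 (\<forall>z\<in>unit_disc. f z = g (\<omega> z)))"

definition ma_minda :: "(complex \<Rightarrow> complex) \<Rightarrow> bool" where
  "ma_minda \<phi> \<longleftrightarrow>
     \<phi> holomorphic_on unit_disc \<and> inj_on \<phi> unit_disc \<and>
     \<phi> ` unit_disc \<subseteq> {w. Re w > 0} \<and>
     cnj ` \<phi> ` unit_disc = \<phi> ` unit_disc \<and>
     \<phi> 0 = 1 \<and> (\<forall>w\<in>\<phi> ` unit_disc. closed_segment 1 w \<subseteq> \<phi> ` unit_disc) \<and>
     deriv \<phi> 0 \<in> \<real> \<and> Re (deriv \<phi> 0) > 0"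

text \<open>
  A zero of the denominator in the quotient below is excluded automatically when \<open>\<phi>\<close> is a
  Ma-Minda function: division by zero gives 0, which is not a value of \<open>\<phi>\<close>.
\<close>

definition class_C_s :: "(complex \<Rightarrow> complex) \<Rightarrow> (complex \<Rightarrow> complex) set" where
  "class_C_s \<phi> = {f \<in> class_A.
     (\<lambda>z. 2 * deriv (\<lambda>w. w * deriv f w) z / (deriv f z + deriv f (- z))) \<prec> \<phi>}"

text \<open>The first argument is the function whose majorant enters, i.e. \<open>K'\<close>.\<close>

definition R_s :: "(complex \<Rightarrow> complex) \<Rightarrow> (complex \<Rightarrow> complex) \<Rightarrow> real \<Rightarrow> real" where
  "R_s K' \<phi> r =
     integral {0..r} (\<lambda>s. 1 / s * integral {0..s} (\<lambda>t. majorant K' t * majorant \<phi> t))"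

text \<open>
  For a Ma-Minda function \<open>\<phi>\<close> and the associated \<open>k\<close>, both \<open>k'\<close> and \<open>\<phi>\<close> are real and positive
  on the interval from -1 to 1, so \<open>Re\<close> only converts the type and \<open>sqrt\<close> is the value of the
  branch of the square root of \<open>k'\<close> that is 1 at the origin.
  For \<open>r = 1\<close> the integrands are bounded, and their (meaningless) values at the endpoint 1 are
  irrelevant for the integrals.
\<close>

definition L_s :: "(complex \<Rightarrow> complex) \<Rightarrow> (complex \<Rightarrow> complex) \<Rightarrow> real \<Rightarrow> real" where
  "L_s k \<phi> r =
     integral {0..r} (\<lambda>s. 1 / s * integral {0..s}
       (\<lambda>t. sqrt (Re (deriv k (of_real (- (t\<^sup>2))))) * Re (\<phi> (of_real (- t)))))"

end

theory Submission
  imports Defs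
begin

text \<open>
  The estimates for \<open>f\<close> come from \<open>Re \<phi> > 0\<close>. Let \<open>\<omega>\<close> be the Schwarz function of the
  subordination, \<open>p = \<phi> \<circ> \<omega>\<close> and \<open>G z = (f' z + f' (- z)) / 2\<close>. Then \<open>Re p > 0\<close>, \<open>p 0 = 1\<close>,
  and \<open>f \<in> class_C_s \<phi>\<close> says that \<open>h z = z * f' z\<close> satisfies \<open>h' = p * G\<close>. Two estimates
  follow that are the same for all \<open>\<phi>\<close>:

  \<^item> \<open>\<bar>a\<^sub>n\<bar> \<le> 1\<close> for \<open>n \<ge> 2\<close> (\<open>coeff_bound_wrt_symmetric_points\<close>), by comparing coefficients in
    \<open>h' = p * G\<close> and using \<open>\<bar>p\<^sub>n\<bar> \<le> 2\<close>;
  \<^item> \<open>d (0, \<partial> f(\<D>)) \<ge> 1 / 2\<close> (\<open>covering_wrt_symmetric_points\<close>).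

  For \<open>r \<le> 1 / 3\<close> they give \<open>r + \<Sum> \<bar>a\<^sub>n\<bar> r\<^sup>n \<le> r + r\<^sup>2 / (1 - r) \<le> 1 / 3 + 1 / 6 = 1 / 2\<close>, which is
  the inequality. The other half of the assertion is that \<open>r_f\<close> exists: \<open>R_s\<close> is continuous,
  vanishes at 0 and satisfies \<open>R_s r \<ge> r + \<bar>\<phi>' 0\<bar> r\<^sup>2 / 4\<close>, so it exceeds 1 before \<open>r\<close> reaches 1,
  while \<open>0 < L_s 1 \<le> 1\<close> because \<open>0 < \<phi> \<le> 1\<close> and \<open>0 < k' \<le> 1\<close> on the interval from -1 to 0.

  The distance estimate integrates lower bounds for derivatives, which is legitimate for
  injective functions. Averaging \<open>h' = p * G\<close> over \<open>z\<close> and \<open>- z\<close> shows that \<open>F z = z * G z\<close> has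
  \<open>z F' / F = (p z + p (- z)) / 2\<close>, which has positive real part: \<open>F\<close> is starlike. As
  \<open>z h' / F = p\<close>, the function \<open>h\<close> is close-to-convex relative to \<open>F\<close>, hence injective, and
  \<open>\<bar>p\<bar> \<ge> (1 - r) / (1 + r)\<close>, \<open>\<bar>G\<bar> \<ge> 1 / (1 + r)\<^sup>2\<close> integrate to \<open>\<bar>h\<bar> \<ge> r / (1 + r)\<^sup>2\<close>, that is
  \<open>\<bar>f'\<bar> \<ge> 1 / (1 + r)\<^sup>2\<close>. Next \<open>f\<close> is close-to-convex relative to the odd part
  \<open>g z = (f z - f (- z)) / 2\<close>, whose derivative is \<open>G\<close>; this takes two arguments at the first zero
  of a real part (\<open>first_zero_of_Re\<close>). So \<open>f\<close> is injective too, and integrating once more shows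
  that its image contains the disc of radius \<open>1 / 2\<close>.

  That close-to-convex functions are injective (\<open>close_to_convex_imp_inj_on\<close>) comes from the
  Loewner chain \<open>(1 - l) * f + l * g\<close> that joins \<open>f\<close> to the starlike function \<open>g\<close>: as \<open>l\<close> grows,
  solutions move towards the origin, so a pair of points with a common value could always be
  replaced by a pair closer to the origin, which compactness forbids.
\<close>

section \<open>The first zero of a real part\<close>

lemma has_real_derivative_Re_along:
  assumes "(\<gamma> has_vector_derivative v) (at t)" and "(U has_field_derivative D) (at (\<gamma> t))"
  shows "((\<lambda>t. Re (U (\<gamma> t))) has_real_derivative Re (D * v)) (at t)"
proof -
  have "(U \<circ> \<gamma> has_vector_derivative v * D) (at t)"
    by (rule field_vector_diff_chain_at[OF assms])
  from bounded_linear.has_vector_derivative[OF bounded_linear_Re this]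
  show ?thesis
    by (simp add: has_real_derivative_iff_has_vector_derivative o_def mult.commute)
qed

text \<open>
  Take a zero \<open>z0\<close> of \<open>Re U\<close> of least modulus. Then \<open>Re U\<close> is nonnegative on the circle through \<open>z0\<close>,
  so its angular derivative vanishes at \<open>z0\<close>, and its radial derivative there is not positive.
  These are the two statements about \<open>z0 * deriv U z0\<close>. The lemma turns a differential relation for
  \<open>U\<close> into \<open>Re U > 0\<close>.
\<close>

lemma first_zero_of_Re:
  assumes hol: "U holomorphic_on unit_disc" and U0: "Re (U 0) > 0"
    and a: "a \<in> unit_disc" "Re (U a) \<le> 0"
  obtains z0 where "z0 \<in> unit_disc" "Re (U z0) = 0" "Im (z0 * deriv U z0) = 0"
    "Re (z0 * deriv U z0) \<le> 0"
proof -
  define S where "S = {z \<in> cball 0 (cmod a). Re (U z) \<le> 0}"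
  have sub: "cball 0 (cmod a) \<subseteq> unit_disc" using a by auto
  have cont: "continuous_on (cball 0 (cmod a)) (\<lambda>z. Re (U z))"
    by (intro continuous_intros holomorphic_on_imp_continuous_on holomorphic_on_subset[OF hol sub])
  have "closed S"
    unfolding S_def using continuous_closed_preimage[OF cont, of "{..0}"]
    by (simp add: vimage_def Int_def)
  moreover have "bounded S"
    by (rule bounded_subset[OF bounded_cball[of 0 "cmod a"]]) (auto simp: S_def)
  ultimately have "compact S" by (simp add: compact_eq_bounded_closed)
  moreover have "S \<noteq> {}" using a by (auto simp: S_def)
  ultimately obtain z0 where z0: "z0 \<in> S" and z0min: "\<And>z. z \<in> S \<Longrightarrow> cmod z0 \<le> cmod z"
    using continuous_attains_inf[OF _ _ continuous_on_norm_id] by metis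
  have z0d: "z0 \<in> unit_disc" using z0 sub by (auto simp: S_def)
  have pos: "Re (U z) > 0" if "cmod z < cmod z0" for z
    using z0min[of z] z0 that by (force simp: S_def)
  have "z0 \<noteq> 0" using z0 U0 by (auto simp: S_def)
  have der: "(U has_field_derivative deriv U z) (at z)" if "z \<in> unit_disc" for z
    using hol that holomorphic_derivI open_ball by blast
  have nonneg: "Re (U z) \<ge> 0" if z: "cmod z = cmod z0" for z
  proof (rule ccontr)
    assume "\<not> Re (U z) \<ge> 0"
    then have neg: "Re (U z) < 0" by simp
    have zd: "z \<in> unit_disc" using z z0d by simp
    have ft: "((\<lambda>t. Re (U (of_real t * z))) \<longlongrightarrow> Re (U (of_real 1 * z))) (at_left 1)"
    proof (intro tendsto_Re isCont_tendsto_compose[where g = U])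
      show "isCont U (of_real 1 * z)" using der[OF zd] DERIV_isCont by simp
    qed (intro tendsto_intros)
    have "eventually (\<lambda>t. Re (U (of_real t * z)) < 0) (at_left (1::real))"
      using order_tendstoD(2)[OF ft, of 0] neg by simp
    moreover have "eventually (\<lambda>t. t \<in> {0<..<1}) (at_left (1::real))"
      by (rule eventually_at_leftI[of 0]) auto
    ultimately have "eventually (\<lambda>t::real. False) (at_left 1)"
    proof eventually_elim
      case (elim t)
      have "cmod (of_real t * z) < cmod z0"
        using elim z \<open>z0 \<noteq> 0\<close> by (simp add: norm_mult)
      from pos[OF this] elim show False by simp
    qed
    then show False by simp
  qed
  have zero: "Re (U z0) = 0" using nonneg[of z0] z0 by (simp add: S_def)
  \<comment> \<open>Along the ray through \<open>z0\<close> the real part decreases to its first zero.\<close>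
  have rad: "((\<lambda>t. Re (U (of_real t * z0))) has_real_derivative Re (deriv U z0 * z0)) (at 1)"
  proof (rule has_real_derivative_Re_along[where U = U and \<gamma> = "\<lambda>t. of_real t * z0"])
    show "((\<lambda>t. of_real t * z0) has_vector_derivative z0) (at 1)"
      by (auto intro!: derivative_eq_intros)
  qed (simp add: der[OF z0d])
  have "Re (deriv U z0 * z0) \<le> 0"
  proof (rule ccontr)
    assume "\<not> ?thesis"
    then obtain d where d: "d > 0"
      and dec: "\<And>h. 0 < h \<Longrightarrow> h < d \<Longrightarrow> Re (U (of_real (1 - h) * z0)) < Re (U (of_real 1 * z0))"
      using DERIV_pos_inc_left[OF rad] by auto
    define h where "h = min (d/2) (1/2)"
    have h: "0 < h" "h < d" "h < 1" using d by (auto simp: h_def)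
    have "cmod (of_real (1 - h) * z0) < cmod z0"
      using h \<open>z0 \<noteq> 0\<close> unfolding norm_mult norm_of_real by (simp add: algebra_simps)
    from pos[OF this] dec[OF h(1,2)] zero show False by simp
  qed
  moreover
  \<comment> \<open>On the circle through \<open>z0\<close> the real part has a minimum at \<open>z0\<close>.\<close>
  have "((\<lambda>t. Re (U (z0 * cis t))) has_real_derivative Re (deriv U z0 * (z0 * \<i>))) (at 0)"
  proof (rule has_real_derivative_Re_along[where U = U and \<gamma> = "\<lambda>t. z0 * cis t"])
    have "((\<lambda>w. z0 * exp (\<i> * w)) has_field_derivative z0 * \<i>) (at (of_real 0))"
      by (auto intro!: derivative_eq_intros)
    then have "((\<lambda>t. z0 * exp (\<i> * of_real t)) has_vector_derivative z0 * \<i>) (at 0)"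
      by (rule has_vector_derivative_real_field)
    then show "((\<lambda>t. z0 * cis t) has_vector_derivative z0 * \<i>) (at 0)"
      by (simp only: cis_conv_exp)
  qed (simp add: der[OF z0d])
  then have "Re (deriv U z0 * (z0 * \<i>)) = 0"
  proof (rule DERIV_local_min[where d = 1])
    show "\<forall>y. \<bar>0 - y\<bar> < 1 \<longrightarrow> Re (U (z0 * cis 0)) \<le> Re (U (z0 * cis y))"
      using nonneg zero by (simp add: norm_mult)
  qed simp
  ultimately show ?thesis
    using that[of z0] z0d zero by (simp add: algebra_simps)
qed

section \<open>Injectivity of close-to-convex functions\<close>

lemma Re_of_real_times: "Re (of_real x * w) = x * Re w"
  by simp

text \<open>
  The step along a Loewner chain: when a positive multiple of \<open>z * s z\<close> is added to \<open>H\<close>, the solution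
  \<open>c\<close> of \<open>H z = H c\<close> moves towards the origin. Indeed the perturbed equation says that
  \<open>\<Psi> z = (H c - H z) / (z * s z)\<close> equals the real parameter \<open>\<epsilon>\<close>; the local inverse of \<open>\<Psi>\<close> moves with velocity
  \<open>- (c * s c) / deriv H c\<close>, which makes an obtuse angle with \<open>c\<close>.
\<close>

lemma solution_moves_inward:
  assumes H: "H holomorphic_on unit_disc" and s: "s holomorphic_on unit_disc"
    and c: "c \<in> unit_disc" "c \<noteq> 0" "s c \<noteq> 0" and pos: "Re (deriv H c / s c) > 0" and "e > 0"
  shows "\<exists>d>0. \<forall>\<epsilon>. 0 < \<epsilon> \<and> \<epsilon> < d \<longrightarrow>
           (\<exists>z. cmod z < cmod c \<and> dist z c < e \<and> H z + of_real \<epsilon> * (z * s z) = H c)"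
proof -
  define A where "A = (unit_disc \<inter> (\<lambda>z. z * s z) -` (- {0})) \<inter> ball c e"
  define \<Psi> where "\<Psi> z = (H c - H z) / (z * s z)" for z
  have contg: "continuous_on unit_disc (\<lambda>z. z * s z)"
    using s by (intro continuous_intros holomorphic_on_imp_continuous_on)
  have "open (unit_disc \<inter> (\<lambda>z. z * s z) -` (- {0}))"
    by (rule continuous_open_preimage[OF contg]) auto
  then have opA: "open A" unfolding A_def by blast
  have cA: "c \<in> A" using c \<open>e > 0\<close> by (simp add: A_def)
  have AD: "A \<subseteq> unit_disc" and Anz: "\<And>z. z \<in> A \<Longrightarrow> z * s z \<noteq> 0"
    by (auto simp: A_def)
  have hol\<Psi>: "\<Psi> holomorphic_on A"
    unfolding \<Psi>_def using Anz
    by (intro holomorphic_intros holomorphic_on_subset[OF H AD] holomorphic_on_subset[OF s AD]) auto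
  have dH: "(H has_field_derivative deriv H c) (at c)"
    and ds: "(s has_field_derivative deriv s c) (at c)"
    using H s c holomorphic_derivI open_ball by blast+
  have "(\<Psi> has_field_derivative - deriv H c / (c * s c)) (at c)"
    unfolding \<Psi>_def using c
    by (auto intro!: derivative_eq_intros dH ds simp: field_simps)
  then have d\<Psi>: "deriv \<Psi> c = - deriv H c / (c * s c)" by (rule DERIV_imp_deriv)
  have nz: "deriv H c \<noteq> 0" using pos by auto
  then have "deriv \<Psi> c \<noteq> 0" using c by (simp add: d\<Psi>)
  then obtain r where r: "r > 0" "ball c r \<subseteq> A" "open (\<Psi> ` ball c r)" "inj_on \<Psi> (ball c r)"
    using has_complex_derivative_locally_invertible[OF hol\<Psi> cA opA] by blast
  obtain \<psi> where \<psi>: "\<psi> holomorphic_on (\<Psi> ` ball c r)"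
      "\<And>z. z \<in> ball c r \<Longrightarrow> deriv \<Psi> z * deriv \<psi> (\<Psi> z) = 1"
      "\<And>z. z \<in> ball c r \<Longrightarrow> \<psi> (\<Psi> z) = z"
    using holomorphic_has_inverse[OF holomorphic_on_subset[OF hol\<Psi> r(2)] open_ball r(4)] by blast
  have cr: "c \<in> ball c r" using r(1) by simp
  have \<Psi>c: "\<Psi> c = 0" by (simp add: \<Psi>_def)
  have zin: "0 \<in> \<Psi> ` ball c r" using \<Psi>c cr by force
  obtain \<eta> where \<eta>: "\<eta> > 0" "ball 0 \<eta> \<subseteq> \<Psi> ` ball c r"
    using r(3) zin open_contains_ball by blast
  have \<psi>0: "\<psi> 0 = c" using \<psi>(3)[OF cr] \<Psi>c by simp
  define v where "v = - (c * s c) / deriv H c"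
  have "deriv \<psi> 0 = v"
    using \<psi>(2)[OF cr] nz c unfolding \<Psi>c d\<Psi> v_def
    by (simp add: field_simps) (metis minus_equation_iff)
  then have d\<psi>: "(\<psi> has_field_derivative v) (at (of_real 0))"
    using holomorphic_derivI[OF \<psi>(1) r(3) zin] by simp
  have vec: "((\<lambda>t. \<psi> (of_real t)) has_vector_derivative v) (at 0)"
    by (rule has_vector_derivative_real_field[OF d\<psi>])
  have dRe: "((\<lambda>t. Re (\<psi> (of_real t))) has_real_derivative Re v) (at 0)"
    and dIm: "((\<lambda>t. Im (\<psi> (of_real t))) has_real_derivative Im v) (at 0)"
    using bounded_linear.has_vector_derivative[OF bounded_linear_Re vec]
      bounded_linear.has_vector_derivative[OF bounded_linear_Im vec]
    by (simp_all add: has_real_derivative_iff_has_vector_derivative)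
  have "((\<lambda>t. (cmod (\<psi> (of_real t)))\<^sup>2) has_real_derivative 2 * Re (cnj c * v)) (at 0)"
    unfolding cmod_power2
    using DERIV_add[OF DERIV_power[OF dRe, of 2] DERIV_power[OF dIm, of 2]]
    by (simp add: \<psi>0 algebra_simps)
  moreover have "Re (cnj c * v) < 0"
  proof -
    have eq: "cnj c * v = - (of_real ((cmod c)\<^sup>2) * inverse (deriv H c / s c))"
      using nz c complex_norm_square[of c] by (simp add: v_def field_simps)
    have inv_pos: "Re (inverse w) > 0" if "Re w > 0" for w
      using that by (auto intro!: divide_pos_pos add_pos_nonneg)
    have "Re (of_real ((cmod c)\<^sup>2) * inverse (deriv H c / s c))
        = (cmod c)\<^sup>2 * Re (inverse (deriv H c / s c))"
      by (subst Re_of_real_times) simp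
    moreover have "\<dots> > 0" using inv_pos[OF pos] c by simp
    ultimately have "Re (of_real ((cmod c)\<^sup>2) * inverse (deriv H c / s c)) > 0" by simp
    then show ?thesis by (simp add: eq)
  qed
  ultimately obtain d where d: "d > 0"
    "\<And>h. 0 < h \<Longrightarrow> h < d \<Longrightarrow> (cmod (\<psi> (of_real h)))\<^sup>2 < (cmod c)\<^sup>2"
    using DERIV_neg_dec_right[of "\<lambda>t. (cmod (\<psi> (of_real t)))\<^sup>2" "2 * Re (cnj c * v)" 0] \<psi>0
    by auto
  show ?thesis
  proof (intro exI[of _ "min d \<eta>"] conjI allI impI)
    show "min d \<eta> > 0" using d \<eta> by simp
    fix \<epsilon> assume \<epsilon>: "0 < \<epsilon> \<and> \<epsilon> < min d \<eta>"
    then have "of_real \<epsilon> \<in> ball (0::complex) \<eta>" by simp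
    then obtain z where z: "z \<in> ball c r" "of_real \<epsilon> = \<Psi> z" using \<eta>(2) by blast
    have "(cmod z)\<^sup>2 < (cmod c)\<^sup>2" using d(2)[of \<epsilon>] \<epsilon> \<psi>(3)[OF z(1)] z(2) by simp
    then have "cmod z < cmod c" by (simp add: power2_less_imp_less)
    moreover have zA: "z \<in> A" using z r by auto
    then have "dist z c < e" by (simp add: A_def dist_commute)
    moreover have "H z + of_real \<epsilon> * (z * s z) = H c"
      using Anz[OF zA] by (simp add: z(2) \<Psi>_def)
    ultimately show "\<exists>z. cmod z < cmod c \<and> dist z c < e \<and> H z + of_real \<epsilon> * (z * s z) = H c"
      by blast
  qed
qed

text \<open>
  The integral form makes the quotient \<open>(f a - f b) / (a - b)\<close> continuous up to the diagonal, where it is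
  \<open>deriv f a\<close>.
\<close>

definition divided_difference :: "(complex \<Rightarrow> complex) \<Rightarrow> complex \<Rightarrow> complex \<Rightarrow> complex" where
  "divided_difference f a b = integral {0..1} (\<lambda>t. deriv f (b + of_real t * (a - b)))"

lemma segment_in_unit_disc:
  assumes "a \<in> unit_disc" "b \<in> unit_disc" "t \<in> {0..1}"
  shows "b + of_real t * (a - b) \<in> unit_disc"
proof -
  have "(1 - t) *\<^sub>R b + t *\<^sub>R a \<in> unit_disc"
    by (rule convexD[OF convex_ball]) (use assms in auto)
  then show ?thesis by (simp add: scaleR_conv_of_real algebra_simps)
qed

lemma divided_difference_mult:
  assumes f: "f holomorphic_on unit_disc" and ab: "a \<in> unit_disc" "b \<in> unit_disc"
  shows "(a - b) * divided_difference f a b = f a - f b"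
proof -
  have "((\<lambda>t. f (b + of_real t * (a - b))) has_vector_derivative
           (a - b) * deriv f (b + of_real t * (a - b))) (at t within {0..1})"
    if "t \<in> {0..1}" for t :: real
  proof -
    have 1: "((\<lambda>t. b + of_real t * (a - b)) has_vector_derivative (a - b)) (at t)"
      by (auto intro!: derivative_eq_intros)
    have 2: "(f has_field_derivative deriv f (b + of_real t * (a - b))) (at (b + of_real t * (a - b)))"
      using holomorphic_derivI[OF f open_ball segment_in_unit_disc[OF ab that]] .
    from field_vector_diff_chain_at[OF 1 2] show ?thesis
      by (simp add: o_def has_vector_derivative_at_within)
  qed
  from fundamental_theorem_of_calculus[OF _ this]
  have "((\<lambda>t. (a - b) * deriv f (b + of_real t * (a - b))) has_integral f a - f b) {0..1}"
    by simp
  then show ?thesis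
    unfolding divided_difference_def by (metis integral_mult_right integral_unique)
qed

lemma divided_difference_same: "divided_difference f a a = deriv f a"
  by (simp add: divided_difference_def)

lemma continuous_on_divided_difference:
  assumes f: "f holomorphic_on unit_disc"
  shows "continuous_on (unit_disc \<times> unit_disc) (\<lambda>x. divided_difference f (fst x) (snd x))"
proof -
  have cont: "continuous_on unit_disc (deriv f)"
    using f by (intro holomorphic_on_imp_continuous_on holomorphic_deriv) auto
  have "continuous_on ((unit_disc \<times> unit_disc) \<times> cbox 0 (1::real))
     (\<lambda>y. deriv f (snd (fst y) + of_real (snd y) * (fst (fst y) - snd (fst y))))"
  proof (rule continuous_on_compose2[OF cont])
    show "(\<lambda>y. snd (fst y) + of_real (snd y) * (fst (fst y) - snd (fst y))) `
        ((unit_disc \<times> unit_disc) \<times> cbox 0 (1::real)) \<subseteq> unit_disc"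
      using segment_in_unit_disc by (fastforce simp del: mem_ball)
  qed (intro continuous_intros)
  then have "continuous_on ((unit_disc \<times> unit_disc) \<times> cbox 0 (1::real))
     (\<lambda>(x, t). deriv f (snd x + of_real t * (fst x - snd x)))"
    by (simp add: case_prod_unfold)
  from integral_continuous_on_param[OF this] show ?thesis
    by (simp add: divided_difference_def)
qed

text \<open>
  With \<open>g z = z * s z\<close>, the hypotheses say that \<open>g\<close> is starlike and that \<open>f\<close> is close-to-convex relative to \<open>g\<close>. Call
  \<open>(l, a, b)\<close> a collision if the divided difference of \<open>(1 - l) * f + l * g\<close> at \<open>a\<close>, \<open>b\<close> vanishes. No
  collision lies on the diagonal, because the derivative of every such combination is nonzero. If \<open>f\<close> were not
  injective, the collisions in some closed disc would form a nonempty compact set, and one of them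
  would have least \<open>max (cmod a) (cmod b)\<close>. Adding \<open>\<epsilon> * g\<close> yields, up to the factor \<open>1 + \<epsilon>\<close>, a combination of
  the same kind with a collision closer to the origin.
\<close>

lemma close_to_convex_imp_inj_on:
  assumes f: "f holomorphic_on unit_disc" and s: "s holomorphic_on unit_disc"
    and s0: "\<And>z. z \<in> unit_disc \<Longrightarrow> s z \<noteq> 0"
    and g: "\<And>z. z \<in> unit_disc \<Longrightarrow> Re (deriv (\<lambda>w. w * s w) z / s z) > 0"
    and fs: "\<And>z. z \<in> unit_disc \<Longrightarrow> Re (deriv f z / s z) > 0"
  shows "inj_on f unit_disc"
proof (rule inj_onI, rule ccontr)
  fix x y assume xy: "x \<in> unit_disc" "y \<in> unit_disc" "f x = f y" "x \<noteq> y"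
  define g where "g z = z * s z" for z
  have holg: "g holomorphic_on unit_disc" unfolding g_def by (intro holomorphic_intros s)
  have gs: "Re (deriv g z / s z) > 0" if "z \<in> unit_disc" for z
    using g[OF that] by (simp add: g_def[abs_def])
  define R where "R = max (cmod x) (cmod y)"
  have sub: "cball 0 R \<subseteq> unit_disc" using xy by (auto simp: R_def)
  let ?X = "{0..1::real} \<times> (cball (0::complex) R \<times> cball (0::complex) R)"
  define D where "D u = (1 - of_real (fst u)) * divided_difference f (fst (snd u)) (snd (snd u))
      + of_real (fst u) * divided_difference g (fst (snd u)) (snd (snd u))" for u
  define T where "T = ?X \<inter> D -` {0}"
  have contdd: "continuous_on ?X (\<lambda>u. divided_difference F (fst (snd u)) (snd (snd u)))"
    if "F holomorphic_on unit_disc" for F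
    by (rule continuous_on_compose2[OF continuous_on_divided_difference[OF that]])
       (use sub in \<open>auto intro!: continuous_intros\<close>)
  have "continuous_on ?X D"
    unfolding D_def by (intro continuous_intros contdd f holg)
  then have "closed T" unfolding T_def
    by (rule continuous_closed_preimage) (auto intro!: closed_Times)
  moreover have "compact ?X" by (intro compact_Times compact_cball) auto
  ultimately have "compact T"
    by (metis T_def compact_Int_closed inf.idem inf_commute inf_left_commute)
  moreover have "T \<noteq> {}"
  proof -
    have "divided_difference f x y = 0" using divided_difference_mult[OF f xy(1,2)] xy by auto
    then have "(0, x, y) \<in> T" by (simp add: T_def D_def R_def)
    then show ?thesis by blast
  qed
  moreover have "continuous_on T (\<lambda>u. max (cmod (fst (snd u))) (cmod (snd (snd u))))"
    by (intro continuous_intros)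
  ultimately obtain u where uT: "u \<in> T"
    and umin: "\<And>u'. u' \<in> T \<Longrightarrow> max (cmod (fst (snd u))) (cmod (snd (snd u)))
        \<le> max (cmod (fst (snd u'))) (cmod (snd (snd u')))"
    using continuous_attains_inf[of T "\<lambda>u. max (cmod (fst (snd u))) (cmod (snd (snd u)))"] by blast
  obtain l a b where u: "u = (l, a, b)" by (metis prod.collapse)
  have l: "0 \<le> l" "l \<le> 1" and abR: "cmod a \<le> R" "cmod b \<le> R"
    and zero: "(1 - of_real l) * divided_difference f a b + of_real l * divided_difference g a b = 0"
    using uT by (auto simp: T_def D_def u)
  have ab: "a \<in> unit_disc" "b \<in> unit_disc" using abR sub by auto
  define M where "M = max (cmod a) (cmod b)"
  have Mmin: "M \<le> max (cmod a') (cmod b')" if "(l', a', b') \<in> T" for l' a' b'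
    using umin[OF that] by (simp add: u M_def)
  define H where "H z = (1 - of_real l) * f z + of_real l * g z" for z
  have holH: "H holomorphic_on unit_disc" unfolding H_def by (intro holomorphic_intros f holg)
  have dH: "deriv H z = (1 - of_real l) * deriv f z + of_real l * deriv g z"
    if "z \<in> unit_disc" for z
    unfolding H_def
    by (intro DERIV_imp_deriv)
       (auto intro!: derivative_eq_intros holomorphic_derivI[OF f open_ball that]
          holomorphic_derivI[OF holg open_ball that])
  have posH: "Re (deriv H z / s z) > 0" if "z \<in> unit_disc" for z
  proof -
    have "deriv H z / s z = of_real (1 - l) * (deriv f z / s z) + of_real l * (deriv g z / s z)"
      by (simp add: dH[OF that] add_divide_distrib)
    then have "Re (deriv H z / s z) = (1 - l) * Re (deriv f z / s z) + l * Re (deriv g z / s z)"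
      by (simp only: plus_complex.sel Re_of_real_times)
    moreover have "\<dots> > 0"
      using l fs[OF that] gs[OF that]
      by (cases "l = 0") (auto intro!: add_nonneg_pos mult_pos_pos mult_nonneg_nonneg)
    ultimately show ?thesis by simp
  qed
  have "a \<noteq> b"
  proof
    assume "a = b"
    then have "deriv H a = 0" using zero ab by (simp add: dH divided_difference_same)
    then show False using posH[OF ab(1)] by simp
  qed
  have diff: "(c - d) * ((1 - of_real m) * divided_difference f c d + of_real m * divided_difference g c d)
     = (1 - of_real m) * (f c - f d) + of_real m * (g c - g d)"
    if "c \<in> unit_disc" "d \<in> unit_disc" for c d and m :: real
    unfolding divided_difference_mult[OF f that, symmetric] divided_difference_mult[OF holg that, symmetric]
    by (simp add: algebra_simps)
  have Hab: "H a = H b" using diff[OF ab, of l] unfolding zero by (simp add: H_def algebra_simps)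
  have "M > 0" using \<open>a \<noteq> b\<close> by (auto simp: M_def less_max_iff_disj)
  have move: "\<exists>d>0. \<forall>\<epsilon>. 0 < \<epsilon> \<and> \<epsilon> < d \<longrightarrow>
           (\<exists>z. cmod z < M \<and> dist z c < dist a b / 2 \<and> H z + of_real \<epsilon> * g z = H c)"
    if c: "c \<in> unit_disc" "cmod c \<le> M" for c
  proof (cases "c = 0")
    case True
    \<comment> \<open>As \<open>g\<close> vanishes at 0, the solution 0 stays where it is, and it lies inside the circle of radius \<open>M\<close>.\<close>
    then show ?thesis
      using \<open>M > 0\<close> \<open>a \<noteq> b\<close> by (intro exI[of _ 1]) (auto intro!: exI[of _ 0] simp: g_def)
  next
    case False
    have "dist a b / 2 > 0" using \<open>a \<noteq> b\<close> by simp
    from solution_moves_inward[OF holH s c(1) False s0[OF c(1)] posH[OF c(1)] this]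
    show ?thesis unfolding g_def using c(2) by (meson less_le_trans)
  qed
  obtain d1 where d1: "d1 > 0" "\<And>\<epsilon>. 0 < \<epsilon> \<and> \<epsilon> < d1 \<Longrightarrow>
           (\<exists>z. cmod z < M \<and> dist z a < dist a b / 2 \<and> H z + of_real \<epsilon> * g z = H a)"
    using move[OF ab(1)] by (auto simp: M_def)
  obtain d2 where d2: "d2 > 0" "\<And>\<epsilon>. 0 < \<epsilon> \<and> \<epsilon> < d2 \<Longrightarrow>
           (\<exists>z. cmod z < M \<and> dist z b < dist a b / 2 \<and> H z + of_real \<epsilon> * g z = H b)"
    using move[OF ab(2)] by (auto simp: M_def)
  define \<epsilon> where "\<epsilon> = min d1 d2 / 2"
  have \<epsilon>: "0 < \<epsilon>" "\<epsilon> < d1" "\<epsilon> < d2" using d1(1) d2(1) by (auto simp: \<epsilon>_def min_def)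
  obtain a' where a': "cmod a' < M" "dist a' a < dist a b / 2" "H a' + of_real \<epsilon> * g a' = H a"
    using d1(2) \<epsilon> by blast
  obtain b' where b': "cmod b' < M" "dist b' b < dist a b / 2" "H b' + of_real \<epsilon> * g b' = H b"
    using d2(2) \<epsilon> by blast
  have "a' \<noteq> b'"
  proof
    assume "a' = b'"
    then have "dist a b < dist a b / 2 + dist a b / 2"
      using a'(2) b'(2) dist_triangle[of a b a'] by (simp add: dist_commute)
    then show False by simp
  qed
  have MR: "M \<le> R" using abR by (simp add: M_def)
  have ab': "a' \<in> unit_disc" "b' \<in> unit_disc" using a' b' MR sub by (auto simp: subset_iff)
  \<comment> \<open>\<open>H + \<epsilon> * g\<close> is \<open>1 + \<epsilon>\<close> times the combination with parameter \<open>m\<close>.\<close>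
  define m where "m = (l + \<epsilon>) / (1 + \<epsilon>)"
  have m: "0 \<le> m" "m \<le> 1" using l \<epsilon> by (auto simp: m_def)
  have m1: "1 - m = (1 - l) / (1 + \<epsilon>)" using \<epsilon> by (simp add: m_def field_simps)
  have mc: "1 - of_real m = ((1 - of_real l) / (1 + of_real \<epsilon>) :: complex)"
    "of_real m = ((of_real l + of_real \<epsilon>) / (1 + of_real \<epsilon>) :: complex)"
  proof -
    have "1 - of_real m = (of_real (1 - m) :: complex)" by simp
    then show "1 - of_real m = ((1 - of_real l) / (1 + of_real \<epsilon>) :: complex)"
      unfolding m1 by simp
  qed (simp add: m_def)
  have comb: "A / X * u + B / X * v = (A * u + B * v) / X" for A B u v X :: complex
    by (simp add: add_divide_distrib)
  have "(1 - of_real m) * (f a' - f b') + of_real m * (g a' - g b')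
     = ((H a' + of_real \<epsilon> * g a') - (H b' + of_real \<epsilon> * g b')) / (1 + of_real \<epsilon>)"
    unfolding mc(1) unfolding mc(2) comb H_def by (rule arg_cong[of _ _ "\<lambda>w. w / _"]) (simp add: algebra_simps)
  also have "\<dots> = 0" using a'(3) b'(3) Hab by simp
  finally have "(m, a', b') \<in> T"
    using diff[OF ab', of m] \<open>a' \<noteq> b'\<close> m a'(1) b'(1) MR by (simp add: T_def D_def)
  from Mmin[OF this] a'(1) b'(1) show False by simp
qed

section \<open>Growth and covering for injective functions\<close>

text \<open>
  The preimage under \<open>h\<close> of the segment from 0 to \<open>w\<close> is a path whose image has length \<open>cmod w\<close>, so along it
  \<open>\<Lambda> (cmod z)\<close> grows at most as fast as the distance covered on the segment. Injectivity of \<open>h\<close> is used to define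
  this path, and to see that the boundary of the image is nonempty: if \<open>h\<close> were onto, its inverse would be a bounded
  entire function. For \<open>w\<close> a boundary point nearest to 0 the path leaves every compact subset of the disc, so \<open>\<Lambda> 1 \<le> cmod w\<close>.
\<close>

lemma univalent_growth_and_covering:
  assumes h: "h holomorphic_on unit_disc" and inj: "inj_on h unit_disc" and h0: "h 0 = 0"
    and cont: "continuous_on {0..1} \<Lambda>" and \<Lambda>0: "\<Lambda> 0 = 0"
    and der: "\<And>t. 0 < t \<Longrightarrow> t < 1 \<Longrightarrow> (\<Lambda> has_real_derivative \<mu> t) (at t)"
    and \<mu>0: "\<And>t. 0 < t \<Longrightarrow> t < 1 \<Longrightarrow> \<mu> t \<ge> 0"
    and le: "\<And>z. z \<in> unit_disc \<Longrightarrow> \<mu> (cmod z) \<le> cmod (deriv h z)"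
  shows univalent_growth: "\<And>z. z \<in> unit_disc \<Longrightarrow> \<Lambda> (cmod z) \<le> cmod (h z)"
    and univalent_covering: "\<Lambda> 1 \<le> infdist 0 (frontier (h ` unit_disc))"
proof -
  have op: "open (h ` unit_disc)" using open_mapping_thm3[OF h open_ball inj] .
  obtain F where F: "F holomorphic_on (h ` unit_disc)"
      "\<And>z. z \<in> unit_disc \<Longrightarrow> deriv h z * deriv F (h z) = 1"
      "\<And>z. z \<in> unit_disc \<Longrightarrow> F (h z) = z"
    using holomorphic_has_inverse[OF h open_ball inj] by blast
  have mono: "\<Lambda> a \<le> \<Lambda> b" if "0 \<le> a" "a \<le> b" "b \<le> 1" for a b
  proof (rule DERIV_nonneg_imp_increasing_open[OF that(2)])
    show "\<exists>y. (\<Lambda> has_real_derivative y) (at x) \<and> 0 \<le> y" if "a < x" "x < b" for x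
      using that \<open>0 \<le> a\<close> \<open>b \<le> 1\<close> der[of x] \<mu>0[of x] by auto
    show "continuous_on {a..b} \<Lambda>" using that by (intro continuous_on_subset[OF cont]) auto
  qed
  have key: "\<Lambda> (cmod (F w)) \<le> cmod w" if sub: "ball 0 d \<subseteq> h ` unit_disc" and w: "w \<in> ball 0 d" for w d
  proof (cases "w = 0")
    case True
    then show ?thesis using F(3)[of 0] h0 \<Lambda>0 by simp
  next
    case False
    define \<gamma> where "\<gamma> t = F (of_real t * w)" for t :: real
    have pre: "\<exists>z. z \<in> unit_disc \<and> of_real t * w = h z \<and> \<gamma> t = z" if "t \<in> {0..1}" for t
    proof -
      have "cmod (of_real t * w) \<le> cmod w" using that by (simp add: norm_mult mult_left_le_one_le)
      then have "of_real t * w \<in> h ` unit_disc" using w sub by auto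
      then obtain z where "z \<in> unit_disc" "of_real t * w = h z" by blast
      with F(3)[of z] show ?thesis by (intro exI[of _ z]) (simp add: \<gamma>_def)
    qed
    have vec: "(\<gamma> has_vector_derivative w * deriv F (of_real t * w)) (at t)" if t: "t \<in> {0..1}" for t
    proof -
      have "of_real t * w \<in> h ` unit_disc" using pre[OF t] by auto
      then have 2: "(F has_field_derivative deriv F (of_real t * w)) (at (of_real t * w))"
        using holomorphic_derivI[OF F(1) op] by blast
      have 1: "((\<lambda>t. of_real t * w) has_vector_derivative w) (at t)"
        by (auto intro!: derivative_eq_intros)
      from field_vector_diff_chain_at[OF 1 2] show ?thesis by (simp add: o_def \<gamma>_def[abs_def])
    qed
    have \<gamma>D: "\<gamma> t \<in> unit_disc" if "t \<in> {0..1}" for t using pre[OF that] by blast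
    have "continuous_on {0..1} \<gamma>"
      by (intro continuous_at_imp_continuous_on ballI has_vector_derivative_continuous[OF vec])
    then have cont\<psi>: "continuous_on {0..1} (\<lambda>t. \<Lambda> (cmod (\<gamma> t)) - t * cmod w)"
    proof (intro continuous_intros continuous_on_compose2[OF cont])
      show "(\<lambda>t. cmod (\<gamma> t)) ` {0..1} \<subseteq> {0..1}"
      proof (rule image_subsetI)
        fix t :: real assume "t \<in> {0..1}"
        from \<gamma>D[OF this] show "cmod (\<gamma> t) \<in> {0..1}" by simp
      qed
    qed
    have "\<Lambda> (cmod (\<gamma> 1)) - 1 * cmod w \<le> \<Lambda> (cmod (\<gamma> 0)) - 0 * cmod w"
    proof (rule DERIV_nonpos_imp_decreasing_open[OF _ _ cont\<psi>])
      fix t :: real assume t: "0 < t" "t < 1"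
      then have t': "t \<in> {0..1}" by simp
      obtain z where z: "z \<in> unit_disc" "of_real t * w = h z" "\<gamma> t = z" using pre[OF t'] by blast
      have "z \<noteq> 0" using z(2) t False h0 by auto
      define v where "v = w * deriv F (of_real t * w)"
      have v: "deriv h z * v = w" using F(2)[OF z(1)] z(2) by (simp add: v_def)
      have "(norm has_derivative (\<lambda>x. x \<bullet> sgn z)) (at (\<gamma> t))"
        unfolding z(3) by (rule has_derivative_norm[OF \<open>z \<noteq> 0\<close>])
      from has_derivative_compose[OF vec[OF t', unfolded has_vector_derivative_def] this]
      have dn: "((\<lambda>t. cmod (\<gamma> t)) has_real_derivative (v \<bullet> sgn z)) (at t)"
        unfolding has_field_derivative_def v_def[symmetric]
        by (rule has_derivative_eq_rhs) (simp add: fun_eq_iff)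
      have c: "0 < cmod (\<gamma> t)" "cmod (\<gamma> t) < 1" using z \<open>z \<noteq> 0\<close> by auto
      have dd: "((\<lambda>t. \<Lambda> (cmod (\<gamma> t)) - t * cmod w) has_real_derivative
          \<mu> (cmod z) * (v \<bullet> sgn z) - cmod w) (at t)"
        using DERIV_diff[OF DERIV_chain2[OF der[OF c] dn] DERIV_cmult_right[OF DERIV_ident, of "cmod w"]]
        unfolding z(3) by simp
      have "v \<bullet> sgn z \<le> cmod v"
        using norm_cauchy_schwarz[of v "sgn z"] \<open>z \<noteq> 0\<close> by (simp add: norm_sgn)
      then have "\<mu> (cmod z) * (v \<bullet> sgn z) \<le> \<mu> (cmod z) * cmod v"
        using \<mu>0[of "cmod z"] c z(3) by (intro mult_left_mono) auto
      also have "\<dots> \<le> cmod (deriv h z) * cmod v"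
        using le[OF z(1)] by (intro mult_right_mono) auto
      also have "\<dots> = cmod w" using v by (metis norm_mult)
      finally show "\<exists>y. ((\<lambda>t. \<Lambda> (cmod (\<gamma> t)) - t * cmod w) has_real_derivative y) (at t) \<and> y \<le> 0"
        using dd by (intro exI conjI) auto
    qed simp
    moreover have "\<gamma> 0 = 0" using F(3)[of 0] h0 by (simp add: \<gamma>_def)
    ultimately show ?thesis using \<Lambda>0 by (simp add: \<gamma>_def)
  qed
  have "h ` unit_disc \<noteq> UNIV"
  proof
    assume U: "h ` unit_disc = UNIV"
    have "range F \<subseteq> unit_disc"
    proof (rule image_subsetI)
      fix w
      obtain z where "z \<in> unit_disc" "w = h z" using U by blast
      then show "F w \<in> unit_disc" using F(3)[of z] by simp
    qed
    then have "bounded (range F)" using bounded_subset bounded_ball by blast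
    then have "F constant_on UNIV" using F(1) U Liouville_theorem by simp
    then have "F (h 0) = F (h (1/2))" by (metis UNIV_I constant_on_def)
    then show False using F(3)[of 0] F(3)[of "1/2"] by simp
  qed
  moreover have zin: "0 \<in> h ` unit_disc" using h0 by force
  ultimately have ne: "frontier (h ` unit_disc) \<noteq> {}" by (auto simp: frontier_eq_empty)
  define d where "d = infdist 0 (frontier (h ` unit_disc))"
  obtain w0 where w0: "w0 \<in> frontier (h ` unit_disc)" "d = cmod w0"
    using infdist_attains_inf[OF frontier_closed ne, of 0] unfolding d_def by auto
  have w0': "w0 \<notin> h ` unit_disc" using w0(1) op by (simp add: frontier_def interior_open)
  then have "d > 0" using w0(2) zin by auto
  have sub: "ball 0 d \<subseteq> h ` unit_disc"
  proof (rule ccontr)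
    assume outside: "\<not> ?thesis"
    have "ball 0 d \<inter> frontier (h ` unit_disc) \<noteq> {}"
    proof (rule connected_Int_frontier[OF connected_ball])
      show "ball 0 d \<inter> h ` unit_disc \<noteq> {}"
        using zin \<open>d > 0\<close> by (metis IntI centre_in_ball empty_iff)
      show "ball 0 d - h ` unit_disc \<noteq> {}" using outside by blast
    qed
    then obtain w where "w \<in> frontier (h ` unit_disc)" "cmod w < d" by auto
    then show False using infdist_le[of w "frontier (h ` unit_disc)" 0] by (simp add: d_def)
  qed
  show cov: "\<Lambda> 1 \<le> infdist 0 (frontier (h ` unit_disc))"
    unfolding d_def[symmetric]
  proof (rule ccontr)
    assume "\<not> \<Lambda> 1 \<le> d"
    then have "\<Lambda> 1 > d" by simp
    have "(\<Lambda> \<longlongrightarrow> \<Lambda> 1) (at_left 1)"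
      using cont by (meson continuous_on_Icc_at_leftD zero_less_one)
    from order_tendstoD(1)[OF this \<open>\<Lambda> 1 > d\<close>]
    have "eventually (\<lambda>t. d < \<Lambda> t) (at_left 1)" .
    moreover have "eventually (\<lambda>t. t \<in> {0<..<1}) (at_left (1::real))"
      by (rule eventually_at_leftI[of 0]) auto
    ultimately have "eventually (\<lambda>t. d < \<Lambda> t \<and> t \<in> {0<..<1}) (at_left 1)"
      by (rule eventually_conj)
    then have "\<exists>t. d < \<Lambda> t \<and> t \<in> {0<..<1}"
      by (rule eventually_happens'[rotated]) simp
    then obtain \<rho> where \<rho>: "0 < \<rho>" "\<rho> < 1" "d < \<Lambda> \<rho>" by auto
    \<comment> \<open>The preimages of the points \<open>t * w0\<close> stay in the disc of radius \<open>\<rho>\<close>, which forces \<open>w0\<close> into the image.\<close>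
    have cD: "cball 0 \<rho> \<subseteq> unit_disc" using \<rho> by auto
    have "compact (h ` cball 0 \<rho>)"
      by (intro compact_continuous_image compact_cball holomorphic_on_imp_continuous_on
          holomorphic_on_subset[OF h cD])
    then have cl: "closed (h ` cball 0 \<rho>)" by (rule compact_imp_closed)
    have "eventually (\<lambda>t. of_real t * w0 \<in> h ` cball 0 \<rho>) (at_left (1::real))"
    proof (rule eventually_at_leftI[of 0])
      fix t :: real assume t: "t \<in> {0<..<1}"
      have n: "cmod (of_real t * w0) < d"
        using t \<open>d > 0\<close> by (simp add: norm_mult w0(2)[symmetric])
      then have b: "of_real t * w0 \<in> ball 0 d" by simp
      then obtain z where z: "z \<in> unit_disc" "of_real t * w0 = h z" using sub by blast
      have "\<Lambda> (cmod z) < d" using key[OF sub b] n F(3)[OF z(1)] z(2) by simp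
      moreover have "\<Lambda> \<rho> \<le> \<Lambda> (cmod z)" if "\<rho> < cmod z"
        using mono[of \<rho> "cmod z"] \<rho> z(1) that by simp
      ultimately have "cmod z \<le> \<rho>" using \<rho>(3) by linarith
      then show "of_real t * w0 \<in> h ` cball 0 \<rho>" using z(2) by auto
    qed simp
    moreover have "((\<lambda>t. of_real t * w0) \<longlongrightarrow> of_real 1 * w0) (at_left (1::real))"
      by (intro tendsto_intros)
    ultimately have "of_real 1 * w0 \<in> h ` cball 0 \<rho>"
      by (intro Lim_in_closed_set[OF cl, of _ "at_left (1::real)"]) simp_all
    then show False using w0' cD by auto
  qed
  show "\<Lambda> (cmod z) \<le> cmod (h z)" if z: "z \<in> unit_disc" for z
  proof (cases "cmod (h z) < d")
    case True
    then show ?thesis using key[OF sub, of "h z"] F(3)[OF z] by simp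
  next
    case False
    have "\<Lambda> (cmod z) \<le> \<Lambda> 1" using z by (intro mono) auto
    then show ?thesis using cov False unfolding d_def[symmetric] by simp
  qed
qed

section \<open>Functions with positive real part\<close>

text \<open>
  Schwarz's lemma for \<open>(p - 1) / (p + 1)\<close>, the Cayley transform of \<open>p\<close>.
\<close>

lemma caratheodory_Re_lower_bound:
  assumes p: "p holomorphic_on unit_disc" and p0: "p 0 = 1"
    and pos: "\<And>z. z \<in> unit_disc \<Longrightarrow> Re (p z) > 0" and z: "z \<in> unit_disc"
  shows "(1 - cmod z) / (1 + cmod z) \<le> Re (p z)"
proof -
  define w where "w z = (p z - 1) / (p z + 1)" for z
  have sq: "(cmod (p z - 1))\<^sup>2 + 4 * Re (p z) = (cmod (p z + 1))\<^sup>2" for z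
    unfolding cmod_power2 by (simp add: power2_eq_square algebra_simps)
  have nz: "p z + 1 \<noteq> 0" if "z \<in> unit_disc" for z
  proof
    assume "p z + 1 = 0"
    then have "Re (p z) = -1" by (metis add_eq_0_iff2 one_complex.sel(1) uminus_complex.sel(1))
    then show False using pos[OF that] by simp
  qed
  have lt: "cmod (w z) < 1" if "cmod z < 1" for z
  proof -
    have "(cmod (p z - 1))\<^sup>2 < (cmod (p z + 1))\<^sup>2" using sq[of z] pos[of z] that by simp
    then have "cmod (p z - 1) < cmod (p z + 1)" by (rule power2_less_imp_less) simp
    then show ?thesis using nz[of z] that by (simp add: w_def norm_divide)
  qed
  have "w holomorphic_on unit_disc" unfolding w_def by (intro holomorphic_intros p nz)
  then have "cmod (w z) \<le> cmod z"
    by (rule Schwarz_Lemma(1)) (use p0 lt z in \<open>auto simp: w_def\<close>)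
  then have "cmod (p z - 1) \<le> cmod z * cmod (p z + 1)"
    using nz[OF z] by (simp add: w_def norm_divide field_simps)
  then have "(cmod (p z - 1))\<^sup>2 \<le> (cmod z * cmod (p z + 1))\<^sup>2" by (rule power_mono) simp
  then have ineq: "(Re (p z) - 1)\<^sup>2 + (Im (p z))\<^sup>2 \<le> (cmod z)\<^sup>2 * ((Re (p z) + 1)\<^sup>2 + (Im (p z))\<^sup>2)"
    by (simp add: power_mult_distrib cmod_power2)
  have "(cmod z)\<^sup>2 * (Im (p z))\<^sup>2 \<le> (Im (p z))\<^sup>2"
    using z by (intro mult_left_le_one_le) (auto simp: power_le_one)
  then have "(1 - Re (p z))\<^sup>2 \<le> (cmod z * (Re (p z) + 1))\<^sup>2"
    using ineq unfolding power_mult_distrib[of "cmod z"] power2_commute[of 1]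
    by (simp add: distrib_left)
  then have "1 - Re (p z) \<le> cmod z * (Re (p z) + 1)"
    by (rule power2_le_imp_le) (use pos[OF z] in simp)
  then show ?thesis by (simp add: pos_divide_le_eq add_pos_nonneg algebra_simps)
qed

text \<open>
  Both \<open>k'\<close> and the even part of \<open>f'\<close> have a logarithmic derivative \<open>(q z - 1) / z\<close> with \<open>Re q > 0\<close>. They are estimated by
  integrating it along rays, for which a holomorphic logarithm is needed.
\<close>

lemma obtain_log_of_solution:
  assumes G: "G holomorphic_on unit_disc" and G0: "G 0 = 1"
    and nz: "\<And>z. z \<in> unit_disc \<Longrightarrow> G z \<noteq> 0"
    and eq: "\<And>z. z \<in> unit_disc \<Longrightarrow> z * deriv G z = (q z - 1) * G z"
  obtains L where "L holomorphic_on unit_disc" "L 0 = 0"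
    "\<And>z. z \<in> unit_disc \<Longrightarrow> G z = exp (L z)"
    "\<And>z. z \<in> unit_disc \<Longrightarrow> z * deriv L z = q z - 1"
proof -
  obtain K where K: "K holomorphic_on unit_disc" "\<And>z. z \<in> unit_disc \<Longrightarrow> G z = exp (K z)"
    using contractible_imp_holomorphic_log[OF G _ nz] convex_imp_contractible[OF convex_ball] by metis
  define L where "L z = K z - K 0" for z
  have hol: "L holomorphic_on unit_disc" unfolding L_def by (intro holomorphic_intros K)
  have "exp (K 0) = 1" using K(2)[of 0] G0 by simp
  then have GL: "G z = exp (L z)" if "z \<in> unit_disc" for z
    using K(2)[OF that] by (simp add: L_def exp_diff)
  have dL: "deriv G z = G z * deriv L z" if "z \<in> unit_disc" for z
  proof (rule DERIV_imp_deriv)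
    have "((\<lambda>z. exp (L z)) has_field_derivative exp (L z) * deriv L z) (at z)"
      by (rule DERIV_fun_exp) (rule holomorphic_derivI[OF hol open_ball that])
    then have "((\<lambda>z. exp (L z)) has_field_derivative G z * deriv L z) (at z)"
      by (simp only: GL[OF that])
    then show "(G has_field_derivative G z * deriv L z) (at z)"
      by (rule has_field_derivative_transform_within_open[OF _ open_ball that]) (simp only: GL)
  qed
  have "z * deriv L z = q z - 1" if "z \<in> unit_disc" for z
    using eq[OF that] nz[OF that] by (simp add: dL[OF that])
  moreover have "L 0 = 0" by (simp add: L_def)
  ultimately show ?thesis using that[OF hol _ GL] by blast
qed

text \<open>
  At distance \<open>t\<close> from the origin, \<open>Re (q - 1) \<ge> (1 - t) / (1 + t) - 1 = - 2 * t / (1 + t)\<close>. Hence the radial derivative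
  of \<open>ln \<bar>G\<bar>\<close>, which is \<open>Re (q - 1) / t\<close>, is at least that of \<open>- 2 * ln (1 + t)\<close>.
\<close>

lemma log_derivative_lower_bound:
  assumes G: "G holomorphic_on unit_disc" and G0: "G 0 = 1"
    and nz: "\<And>z. z \<in> unit_disc \<Longrightarrow> G z \<noteq> 0"
    and q: "q holomorphic_on unit_disc" "q 0 = 1" "\<And>z. z \<in> unit_disc \<Longrightarrow> Re (q z) > 0"
    and eq: "\<And>z. z \<in> unit_disc \<Longrightarrow> z * deriv G z = (q z - 1) * G z"
    and z: "z \<in> unit_disc"
  shows "1 / (1 + cmod z)\<^sup>2 \<le> cmod (G z)"
proof -
  obtain L where L: "L holomorphic_on unit_disc" "L 0 = 0" "\<And>z. z \<in> unit_disc \<Longrightarrow> G z = exp (L z)"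
      and L': "\<And>z. z \<in> unit_disc \<Longrightarrow> z * deriv L z = q z - 1"
    using obtain_log_of_solution[OF G G0 nz eq] by metis
  define r where "r = cmod z"
  have r: "0 \<le> r" "r < 1" using z by (auto simp: r_def)
  define \<psi> where "\<psi> t = Re (L (of_real t * z)) + 2 * ln (1 + t * r)" for t
  have tz: "of_real t * z \<in> unit_disc" "cmod (of_real t * z) = t * r" if "0 \<le> t" "t \<le> 1" for t
    using that r mult_left_le_one_le[of r t] by (auto simp: r_def norm_mult)
  have der: "(\<psi> has_real_derivative Re (deriv L (of_real t * z) * z) + 2 * (r / (1 + t * r))) (at t)"
    if "0 \<le> t" "t \<le> 1" for t
  proof -
    have "((\<lambda>t. Re (L (of_real t * z))) has_real_derivative Re (deriv L (of_real t * z) * z)) (at t)"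
      using holomorphic_derivI[OF L(1) open_ball tz(1)[OF that]]
      by (intro has_real_derivative_Re_along[where U = L and \<gamma> = "\<lambda>t. of_real t * z"])
         (auto intro!: derivative_eq_intros)
    moreover have "1 + t * r > 0" using that r by (simp add: add_pos_nonneg)
    then have "((\<lambda>t. 2 * ln (1 + t * r)) has_real_derivative 2 * (r / (1 + t * r))) (at t)"
      by (auto intro!: derivative_eq_intros)
    ultimately show ?thesis unfolding \<psi>_def by (rule DERIV_add)
  qed
  have "\<psi> 0 \<le> \<psi> 1"
  proof (rule DERIV_nonneg_imp_increasing_open[where f = \<psi> and a = 0 and b = 1])
    show "continuous_on {0..1} \<psi>"
    proof (intro continuous_at_imp_continuous_on ballI)
      fix t :: real assume "t \<in> {0..1}"
      then show "isCont \<psi> t" by (intro DERIV_isCont[OF der]) simp_all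
    qed
    fix t :: real assume t: "0 < t" "t < 1"
    have "t * Re (deriv L (of_real t * z) * z) = Re (of_real t * z * deriv L (of_real t * z))"
      by (simp add: algebra_simps)
    also have "\<dots> = Re (q (of_real t * z)) - 1" using L'[OF tz(1)] t by simp
    also have "\<dots> \<ge> (1 - t * r) / (1 + t * r) - 1"
      using caratheodory_Re_lower_bound[OF q tz(1), of t] tz(2)[of t] t by simp
    also have "(1 - t * r) / (1 + t * r) - 1 = - t * (2 * (r / (1 + t * r)))"
    proof -
      have "1 + t * r > 0" using t r by (simp add: add_pos_nonneg)
      then show ?thesis by (simp add: field_simps)
    qed
    finally have "t * (Re (deriv L (of_real t * z) * z) + 2 * (r / (1 + t * r))) \<ge> 0"
      by (simp add: algebra_simps)
    then have "Re (deriv L (of_real t * z) * z) + 2 * (r / (1 + t * r)) \<ge> 0"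
      using t by (simp add: zero_le_mult_iff)
    with der[OF less_imp_le[OF t(1)] less_imp_le[OF t(2)]]
    show "\<exists>y. (\<psi> has_real_derivative y) (at t) \<and> 0 \<le> y" by blast
  qed simp
  then have "- (2 * ln (1 + r)) \<le> Re (L z)" by (simp add: \<psi>_def L(2))
  then have "exp (- (2 * ln (1 + r))) \<le> cmod (G z)" by (simp add: L(3)[OF z])
  moreover have "exp (- (2 * ln (1 + r))) = 1 / (1 + r)\<^sup>2"
  proof -
    have "exp (2 * ln (1 + r)) = (1 + r)\<^sup>2" using r by (simp add: exp_double)
    then show ?thesis by (simp only: exp_minus inverse_eq_divide)
  qed
  ultimately show ?thesis by (simp add: r_def)
qed

text \<open>
  On the negative axis the logarithm of \<open>G\<close> has the real derivative \<open>(q - 1) / z\<close>, and \<open>q \<le> 1\<close> makes it decrease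
  away from the origin. Hence \<open>G\<close> is positive and at most 1 there.
\<close>

lemma solution_on_negative_axis:
  assumes G: "G holomorphic_on unit_disc" and G0: "G 0 = 1"
    and nz: "\<And>z. z \<in> unit_disc \<Longrightarrow> G z \<noteq> 0"
    and eq: "\<And>z. z \<in> unit_disc \<Longrightarrow> z * deriv G z = (q z - 1) * G z"
    and q: "\<And>t::real. 0 < t \<Longrightarrow> t < 1 \<Longrightarrow> Im (q (- of_real t)) = 0"
      "\<And>t::real. 0 < t \<Longrightarrow> t < 1 \<Longrightarrow> Re (q (- of_real t)) \<le> 1"
    and x: "0 \<le> x" "x < 1"
  shows "Re (G (- of_real x)) = cmod (G (- of_real x))" and "cmod (G (- of_real x)) \<le> 1"
proof -
  obtain L where L: "L holomorphic_on unit_disc" "L 0 = 0" "\<And>z. z \<in> unit_disc \<Longrightarrow> G z = exp (L z)"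
      and L': "\<And>z. z \<in> unit_disc \<Longrightarrow> z * deriv L z = q z - 1"
    using obtain_log_of_solution[OF G G0 nz eq] by metis
  have tD: "- of_real t \<in> unit_disc" if "0 \<le> t" "t < 1" for t :: real using that by simp
  have vec: "((\<lambda>t. L (- of_real t)) has_vector_derivative - deriv L (- of_real t)) (at t)"
    if "0 \<le> t" "t < 1" for t :: real
  proof -
    have 1: "((\<lambda>t. - of_real t :: complex) has_vector_derivative - 1) (at t)"
      by (auto intro!: derivative_eq_intros)
    from field_vector_diff_chain_at[OF 1 holomorphic_derivI[OF L(1) open_ball tD[OF that]]]
    show ?thesis by (simp add: o_def)
  qed
  have dRe: "((\<lambda>t. Re (L (- of_real t))) has_real_derivative - Re (deriv L (- of_real t))) (at t)"
    and dIm: "((\<lambda>t. Im (L (- of_real t))) has_real_derivative - Im (deriv L (- of_real t))) (at t)"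
    if "0 \<le> t" "t < 1" for t :: real
    using bounded_linear.has_vector_derivative[OF bounded_linear_Re vec[OF that]]
      bounded_linear.has_vector_derivative[OF bounded_linear_Im vec[OF that]]
    by (simp_all add: has_real_derivative_iff_has_vector_derivative)
  have L'neg: "t * Re (deriv L (- of_real t)) \<ge> 0" "t * Im (deriv L (- of_real t)) = 0"
    if "0 < t" "t < 1" for t :: real
  proof -
    have e: "of_real t * deriv L (- of_real t) = 1 - q (- of_real t)"
      using L'[OF tD[of t]] that by (simp add: algebra_simps)
    show "t * Re (deriv L (- of_real t)) \<ge> 0"
      using arg_cong[OF e, of Re] q(2)[OF that] by simp
    show "t * Im (deriv L (- of_real t)) = 0"
      using arg_cong[OF e, of Im] q(1)[OF that] by simp
  qed
  have contRe: "continuous_on {0..x} (\<lambda>t. Re (L (- of_real t)))"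
  proof (intro continuous_at_imp_continuous_on ballI)
    fix t assume "t \<in> {0..x}"
    then show "isCont (\<lambda>t. Re (L (- of_real t))) t" using x by (intro DERIV_isCont[OF dRe]) simp_all
  qed
  have contIm: "continuous_on {0..x} (\<lambda>t. Im (L (- of_real t)))"
  proof (intro continuous_at_imp_continuous_on ballI)
    fix t assume "t \<in> {0..x}"
    then show "isCont (\<lambda>t. Im (L (- of_real t))) t" using x by (intro DERIV_isCont[OF dIm]) simp_all
  qed
  have "Re (L (- of_real 0)) \<ge> Re (L (- of_real x))"
  proof (rule DERIV_nonpos_imp_decreasing_open[OF x(1) _ contRe])
    fix t assume t: "0 < t" "t < x"
    then have "t < 1" using x by simp
    have "- Re (deriv L (- of_real t)) \<le> 0"
      using L'neg(1)[OF t(1) \<open>t < 1\<close>] t(1) by (simp add: zero_le_mult_iff)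
    with dRe[OF less_imp_le[OF t(1)] \<open>t < 1\<close>]
    show "\<exists>y. ((\<lambda>t. Re (L (- of_real t))) has_real_derivative y) (at t) \<and> y \<le> 0" by blast
  qed
  then have Re_le: "Re (L (- of_real x)) \<le> 0" by (simp add: L(2))
  have dIm0: "((\<lambda>t. Im (L (- of_real t))) has_real_derivative 0) (at t)" if t: "0 < t" "t < x" for t
  proof -
    have "t < 1" using t x by simp
    then show ?thesis using dIm[of t] L'neg(2)[of t] t by simp
  qed
  have "Im (L (- of_real x)) = 0"
  proof (cases "x = 0")
    case False
    with x have "0 < x" by simp
    from DERIV_isconst_end[OF this contIm dIm0] show ?thesis by (simp add: L(2))
  qed (simp add: L(2))
  then have "L (- of_real x) = of_real (Re (L (- of_real x)))" by (simp add: complex_eq_iff)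
  then have "G (- of_real x) = of_real (exp (Re (L (- of_real x))))"
    using L(3)[OF tD[OF x]] by (metis exp_of_real)
  then show "Re (G (- of_real x)) = cmod (G (- of_real x))" "cmod (G (- of_real x)) \<le> 1"
    using Re_le by simp_all
qed

lemma has_integral_circle_fourier:
  assumes p: "p holomorphic_on unit_disc" and r: "0 < r" "r < 1"
  defines "E \<equiv> \<lambda>x. exp (2 * of_real pi * \<i> * of_real x)"
  shows "((\<lambda>x. p (of_real r * E x) / E x ^ n) has_integral taylor_coeff p n * of_real r ^ n) {0..1::real}"
    and "n > 0 \<Longrightarrow> ((\<lambda>x. p (of_real r * E x) * E x ^ n) has_integral 0) {0..1::real}"
proof -
  have sub: "cball 0 r \<subseteq> unit_disc" using r by auto
  have sub2: "ball 0 r \<subseteq> unit_disc" using r by auto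
  have path: "circlepath 0 r x = of_real r * E x" for x by (simp add: circlepath E_def)
  have E0: "E x \<noteq> 0" for x by (simp add: E_def)
  have vd: "vector_derivative (circlepath 0 r) (at x within {0..1}) = 2 * of_real pi * \<i> * of_real r * E x"
    if "x \<in> {0..1}" for x
    using vector_derivative_circlepath01[of x 0 r] that by (simp add: E_def)
  have ci: "((\<lambda>x. f (of_real r * E x) * (2 * of_real pi * \<i> * of_real r * E x)) has_integral I) {0..1}"
    if "(f has_contour_integral I) (circlepath 0 r)" for f I
    by (rule has_integral_eq[OF _ that[unfolded has_contour_integral_def]]) (simp only: vd path)
  have "((\<lambda>u. p u / (u - 0) ^ Suc n) has_contour_integral
          ((2 * pi * \<i>) / (fact n) * (deriv ^^ n) p 0)) (circlepath 0 r)"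
    by (rule Cauchy_has_contour_integral_higher_derivative_circlepath)
       (use r in \<open>auto intro!: holomorphic_on_imp_continuous_on holomorphic_on_subset[OF p] sub sub2\<close>)
  from has_integral_mult_right[OF ci[OF this], of "of_real r ^ n / (2 * of_real pi * \<i>)"]
  show "((\<lambda>x. p (of_real r * E x) / E x ^ n) has_integral taylor_coeff p n * of_real r ^ n) {0..1::real}"
    using r E0 by (simp add: fps_expansion_def power_mult_distrib field_simps)
  assume n: "n > 0"
  have "((\<lambda>u. p u * u ^ (n - 1)) has_contour_integral 0) (circlepath 0 r)"
    by (rule Cauchy_theorem_convex_simple[of _ "cball 0 r"])
       (use r in \<open>auto intro!: holomorphic_intros holomorphic_on_subset[OF p] sub\<close>)
  from has_integral_mult_right[OF ci[OF this], of "1 / (2 * of_real pi * \<i> * of_real r ^ n)"]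
  show "((\<lambda>x. p (of_real r * E x) * E x ^ n) has_integral 0) {0..1::real}"
    using r E0 n by (cases n) (simp_all add: power_mult_distrib field_simps)
qed

text \<open>
  The conjugate of \<open>p\<close> has no Fourier coefficient of index \<open>n > 0\<close> on a circle about 0, so \<open>p\<close> may be replaced by
  \<open>2 * Re p\<close> in Cauchy's formula for the \<open>n\<close>-th coefficient. As \<open>Re p\<close> is positive, the modulus of the integral is
  at most the mean of \<open>2 * Re p\<close>, which is \<open>2 * Re (p 0)\<close>.
\<close>

lemma caratheodory_coeff_bound:
  assumes p: "p holomorphic_on unit_disc" and p0: "p 0 = 1"
    and pos: "\<And>z. z \<in> unit_disc \<Longrightarrow> Re (p z) > 0" and n: "n > 0"
  shows "cmod (taylor_coeff p n) \<le> 2"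
proof -
  define E where "E x = exp (2 * of_real pi * \<i> * of_real x)" for x :: real
  have normE: "cmod (E x) = 1" for x by (simp add: E_def)
  have cnjE: "cnj (E x) = 1 / E x" for x
    using normE[of x] by (metis complex_div_cnj div_by_1 mult_1 of_real_1 one_power2)
  have bound: "cmod (taylor_coeff p n) * r ^ n \<le> 2" if r: "0 < r" "r < 1" for r
  proof -
    note I = has_integral_circle_fourier[OF p r, folded E_def]
    have "((\<lambda>x. cnj (p (of_real r * E x) * E x ^ n)) has_integral cnj 0) {0..1}"
      using has_integral_linear[OF I(2)[OF n] bounded_linear_cnj] by (simp add: o_def)
    then have "((\<lambda>x. cnj (p (of_real r * E x)) / E x ^ n) has_integral 0) {0..1}"
      by (simp add: cnjE power_divide)
    from has_integral_add[OF I(1)[of n] this]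
    have F: "((\<lambda>x. of_real (2 * Re (p (of_real r * E x))) / E x ^ n) has_integral
        taylor_coeff p n * of_real r ^ n) {0..1}"
      by (simp add: add_divide_distrib[symmetric] complex_add_cnj)
    have "((\<lambda>x. Re (p (of_real r * E x) / E x ^ 0)) has_integral Re (taylor_coeff p 0 * of_real r ^ 0)) {0..1}"
      using has_integral_linear[OF I(1)[of 0] bounded_linear_Re] by (simp add: o_def)
    then have G: "((\<lambda>x. 2 * Re (p (of_real r * E x))) has_integral 2) {0..1}"
      using has_integral_mult_right[of "\<lambda>x. Re (p (of_real r * E x))" 1 "{0..1}" "2::real"]
      by (simp add: fps_expansion_def p0)
    have "of_real r * E x \<in> unit_disc" for x using r by (simp add: norm_mult normE)
    then have Re_pos: "Re (p (of_real r * E x)) > 0" for x using pos by blast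
    have "cmod (integral {0..1} (\<lambda>x. of_real (2 * Re (p (of_real r * E x))) / E x ^ n))
        \<le> integral {0..1} (\<lambda>x. 2 * Re (p (of_real r * E x)))"
    proof (rule integral_norm_bound_integral)
      fix x
      show "cmod (of_real (2 * Re (p (of_real r * E x))) / E x ^ n) \<le> 2 * Re (p (of_real r * E x))"
        using Re_pos[of x] unfolding norm_divide norm_power normE norm_of_real by simp
    qed (use F G in \<open>blast intro: has_integral_integrable\<close>)+
    then have "cmod (taylor_coeff p n * of_real r ^ n) \<le> 2"
      using integral_unique[OF F] integral_unique[OF G] by simp
    then show ?thesis using r by (simp add: norm_mult norm_power)
  qed
  have "((\<lambda>r. cmod (taylor_coeff p n) * r ^ n) \<longlongrightarrow> cmod (taylor_coeff p n) * 1 ^ n) (at_left 1)"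
    by (intro tendsto_intros)
  moreover have "eventually (\<lambda>r. cmod (taylor_coeff p n) * r ^ n \<le> 2) (at_left 1)"
    by (rule eventually_at_leftI[of 0]) (auto intro: bound)
  ultimately show ?thesis
    using tendsto_upperbound[of _ _ "at_left (1::real)"] by fastforce
qed

section \<open>Coefficients and covering radius for convexity with respect to symmetric points\<close>

lemma has_fps_expansion_unit_disc:
  assumes "f holomorphic_on unit_disc"
  shows "f has_fps_expansion fps_expansion f 0"
  by (rule has_fps_expansion_fps_expansion[OF open_ball _ assms]) simp

text \<open>
  Let \<open>B\<^sub>n\<close> be the coefficients of \<open>f'\<close>. The equation reads
  \<open>2 * (m + 1) * B\<^sub>m = (\<Sum>i\<le>m. (1 + (- 1) ^ i) * B\<^sub>i * P\<^sub>m\<^sub>-\<^sub>i)\<close>. For \<open>m > 0\<close>, once the term \<open>i = m\<close> is moved to the left,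
  \<open>B\<^sub>m\<close> has the factor \<open>N = 2 * m + 1 - (- 1) ^ m\<close>; as \<open>\<bar>P\<^sub>j\<bar> \<le> 2\<close> and, by induction, \<open>\<bar>B\<^sub>i\<bar> \<le> 1\<close>, the remaining sum is at most
  \<open>2 * (\<Sum>i<m. 1 + (- 1) ^ i)\<close>, which is exactly \<open>N\<close>.
\<close>

lemma coeff_bound_wrt_symmetric_points:
  assumes f: "f holomorphic_on unit_disc" and f0: "deriv f 0 = 1"
    and p: "p holomorphic_on unit_disc" "p 0 = 1" "\<And>z. z \<in> unit_disc \<Longrightarrow> Re (p z) > 0"
    and eq: "\<And>z. z \<in> unit_disc \<Longrightarrow>
        2 * deriv (\<lambda>w. w * deriv f w) z = p z * (deriv f z + deriv f (- z))"
  shows "cmod (taylor_coeff f (Suc n)) \<le> 1"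
proof -
  define B where "B = fps_expansion (deriv f) 0"
  define P where "P = fps_expansion p 0"
  have B: "deriv f has_fps_expansion B"
    unfolding B_def using f by (intro has_fps_expansion_unit_disc holomorphic_deriv) auto
  have P: "p has_fps_expansion P"
    unfolding P_def by (intro has_fps_expansion_unit_disc p)
  have X: "(\<lambda>z::complex. z) has_fps_expansion fps_X" by (rule has_fps_expansion_fps_X)
  have "(\<lambda>z::complex. (-1) * z) has_fps_expansion fps_const (-1) * fps_X"
    by (intro has_fps_expansion_cmult_left X)
  then have "(deriv f \<circ> (\<lambda>z. (-1) * z)) has_fps_expansion fps_compose B (fps_const (-1) * fps_X)"
    by (rule has_fps_expansion_compose[OF B]) simp
  then have Bm: "(\<lambda>z. deriv f (- z)) has_fps_expansion fps_compose B (fps_const (-1) * fps_X)"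
    by (simp add: o_def)
  have 1: "(\<lambda>z. 2 * deriv (\<lambda>w. w * deriv f w) z) has_fps_expansion fps_const 2 * fps_deriv (fps_X * B)"
    by (intro has_fps_expansion_cmult_left has_fps_expansion_deriv has_fps_expansion_mult X B)
  have 2: "(\<lambda>z. (deriv f z + deriv f (- z)) * p z) has_fps_expansion
      (B + fps_compose B (fps_const (-1) * fps_X)) * P"
    by (intro has_fps_expansion_mult has_fps_expansion_add B Bm P)
  have "eventually (\<lambda>z. z \<in> unit_disc) (nhds (0::complex))"
    by (intro eventually_nhds_in_open) auto
  then have "eventually (\<lambda>z. 2 * deriv (\<lambda>w. w * deriv f w) z = (deriv f z + deriv f (- z)) * p z) (nhds 0)"
    by eventually_elim (use eq in \<open>simp add: mult.commute\<close>)
  then have "(\<lambda>z. 2 * deriv (\<lambda>w. w * deriv f w) z) has_fps_expansion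
      (B + fps_compose B (fps_const (-1) * fps_X)) * P"
    using 2 by (subst has_fps_expansion_cong[OF _ refl])
  then have fps_eq: "fps_const 2 * fps_deriv (fps_X * B) = (B + fps_compose B (fps_const (-1) * fps_X)) * P"
    by (rule fps_expansion_unique_complex[OF 1])
  have coeff: "2 * of_nat (Suc m) * fps_nth B m
      = (\<Sum>i=0..m. ((1 + (-1) ^ i) * fps_nth B i) * fps_nth P (m - i))" for m
  proof -
    have "fps_nth (fps_const 2 * fps_deriv (fps_X * B)) m = 2 * of_nat (Suc m) * fps_nth B m"
      by (simp add: algebra_simps)
    moreover have "fps_nth (B + fps_compose B (fps_const (-1) * fps_X)) i = (1 + (-1) ^ i) * fps_nth B i" for i
      unfolding fps_compose_linear by (simp add: distrib_right)
    ultimately show ?thesis unfolding fps_eq fps_mult_nth by simp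
  qed
  have P0: "fps_nth P 0 = 1" by (simp add: P_def fps_expansion_def p)
  have Pn: "cmod (fps_nth P i) \<le> 2" if "i > 0" for i
    unfolding P_def by (rule caratheodory_coeff_bound[OF p that])
  have sumeq: "(\<Sum>i<m. 1 + (-1) ^ i :: real) = real m + (1 - (-1) ^ m) / 2" for m
    by (induction m) (auto simp: field_simps)
  have Bn: "cmod (fps_nth B m) \<le> 1" for m
  proof (induction m rule: less_induct)
    case (less m)
    show ?case
    proof (cases "m = 0")
      case True
      then show ?thesis by (simp add: B_def fps_expansion_def f0)
    next
      case False
      define N where "N = 2 * real m + 1 - (-1) ^ m"
      have "N > 0" using False by (cases "even m") (auto simp: N_def)
      have "of_real N * fps_nth B m = (\<Sum>i<m. ((1 + (-1) ^ i) * fps_nth B i) * fps_nth P (m - i))"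
        using coeff[of m] unfolding atLeast0AtMost lessThan_Suc_atMost[symmetric] sum.lessThan_Suc
        by (simp add: N_def P0 algebra_simps)
      then have "N * cmod (fps_nth B m) = cmod (\<Sum>i<m. ((1 + (-1) ^ i) * fps_nth B i) * fps_nth P (m - i))"
        using \<open>N > 0\<close> by (metis abs_of_pos norm_mult norm_of_real)
      also have "\<dots> \<le> (\<Sum>i<m. (1 + (-1) ^ i) * 2)"
      proof (rule sum_norm_le)
        fix i assume i: "i \<in> {..<m}"
        have "cmod (1 + (-1) ^ i) = 1 + (-1) ^ i" by (cases "even i") auto
        moreover have "cmod (fps_nth B i) * cmod (fps_nth P (m - i)) \<le> 1 * 2"
          using i by (intro mult_mono less Pn) auto
        moreover have "(0::real) \<le> 1 + (-1) ^ i" by (cases "even i") auto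
        ultimately show "cmod (((1 + (-1) ^ i) * fps_nth B i) * fps_nth P (m - i)) \<le> (1 + (-1) ^ i) * 2"
          unfolding norm_mult mult.assoc by (metis mult_1 mult_left_mono)
      qed
      also have "\<dots> = N" using sumeq[of m] unfolding sum_distrib_right[symmetric] by (simp add: N_def)
      finally show ?thesis using \<open>N > 0\<close> by simp
    qed
  qed
  have "taylor_coeff f (Suc n) = fps_nth B n / of_nat (Suc n)"
    unfolding B_def fps_expansion_def funpow_Suc_right fps_nth_Abs_fps o_apply fact_Suc by simp
  then have "cmod (taylor_coeff f (Suc n)) = cmod (fps_nth B n) / real (Suc n)"
    by (simp add: norm_divide del: of_nat_Suc)
  also have "\<dots> \<le> 1" using Bn[of n] by (simp add: divide_le_eq)
  finally show ?thesis .
qed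

lemma holomorphic_on_reflect:
  assumes "f holomorphic_on unit_disc"
  shows "(\<lambda>z. f (- z)) holomorphic_on unit_disc"
proof -
  have "f \<circ> uminus holomorphic_on unit_disc"
    by (rule holomorphic_on_compose_gen[OF _ assms]) (auto intro!: holomorphic_intros)
  then show ?thesis by (simp add: o_def)
qed

text \<open>
  Here \<open>s\<close> is the holomorphic quotient \<open>g z / z\<close> of the odd part \<open>g\<close> of \<open>f\<close>, \<open>u = g / F\<close> with \<open>F z = z * G z\<close>, and \<open>U = h / g\<close>.
  Differentiating \<open>g = F * u\<close> and \<open>h = U * g\<close> gives \<open>z u' + q u = 1\<close> and \<open>U + u z U' = p\<close>. At a first zero of
  \<open>Re u\<close> the first relation would force \<open>u = 0\<close> and then \<open>z u' = 1\<close>, which contradicts \<open>z u' \<le> 0\<close>; at a first zero of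
  \<open>Re U\<close> the second one would give \<open>Re p = Re u * (z U') \<le> 0\<close>. Since \<open>z g' / g = 1 / u\<close> and \<open>z f' / g = U\<close>, the
  function \<open>g\<close> is starlike and \<open>f\<close> is close-to-convex relative to it.
\<close>

lemma covering_wrt_symmetric_points:
  assumes f: "f holomorphic_on unit_disc" and f0: "f 0 = 0" and f'0: "deriv f 0 = 1"
    and p: "p holomorphic_on unit_disc" and p0: "p 0 = 1"
    and pos: "\<And>z. z \<in> unit_disc \<Longrightarrow> Re (p z) > 0"
    and den: "\<And>z. z \<in> unit_disc \<Longrightarrow> deriv f z + deriv f (- z) \<noteq> 0"
    and eq: "\<And>z. z \<in> unit_disc \<Longrightarrow>
        2 * deriv (\<lambda>w. w * deriv f w) z = p z * (deriv f z + deriv f (- z))"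
  shows "1 / 2 \<le> infdist 0 (frontier (f ` unit_disc))"
proof -
  define G where "G z = (deriv f z + deriv f (- z)) / 2" for z
  define g where "g z = (f z - f (- z)) / 2" for z
  define h where "h z = z * deriv f z" for z
  define q where "q z = (p z + p (- z)) / 2" for z
  have holf': "deriv f holomorphic_on unit_disc" using f by (intro holomorphic_deriv) auto
  have holG: "G holomorphic_on unit_disc" unfolding G_def
    by (intro holomorphic_intros holf' holomorphic_on_reflect) auto
  have holq: "q holomorphic_on unit_disc" unfolding q_def
    by (intro holomorphic_intros p holomorphic_on_reflect) auto
  have holh: "h holomorphic_on unit_disc" unfolding h_def
    by (intro holomorphic_intros holf')
  have holg: "g holomorphic_on unit_disc" unfolding g_def
    by (intro holomorphic_intros f holomorphic_on_reflect) auto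
  have minus: "- z \<in> unit_disc" if "z \<in> unit_disc" for z :: complex using that by simp
  have q0: "q 0 = 1" by (simp add: q_def p0)
  have qpos: "Re (q z) > 0" if "z \<in> unit_disc" for z
    using pos[OF that] pos[OF minus[OF that]] by (simp add: q_def)
  have G0: "G 0 = 1" by (simp add: G_def f'0)
  have Gnz: "G z \<noteq> 0" if "z \<in> unit_disc" for z using den[OF that] by (simp add: G_def)
  have Geven: "G (- z) = G z" for z by (simp add: G_def add.commute)
  have dh': "deriv h z = p z * G z" if "z \<in> unit_disc" for z
  proof -
    have "2 * deriv h z = p z * (2 * G z)"
      using eq[OF that] unfolding h_def[abs_def] by (simp add: G_def)
    then show ?thesis by simp
  qed
  have dh: "(h has_field_derivative p z * G z) (at z)" if "z \<in> unit_disc" for z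
    using holomorphic_derivI[OF holh open_ball that] dh'[OF that] by simp
  have dhm: "((\<lambda>z. h (- z)) has_field_derivative - (p (- z) * G z)) (at z)" if "z \<in> unit_disc" for z
    using DERIV_chain2[OF dh[OF minus[OF that]] DERIV_minus[OF DERIV_ident]] by (simp add: Geven)
  have dG: "(G has_field_derivative deriv G z) (at z)" if "z \<in> unit_disc" for z
    using holomorphic_derivI[OF holG open_ball that] .
  have Feq: "z * G z = (h z - h (- z)) / 2" for z
    by (simp add: h_def G_def algebra_simps)
  have dF: "((\<lambda>z. z * G z) has_field_derivative q z * G z) (at z)" if "z \<in> unit_disc" for z
    using DERIV_cdivide[OF DERIV_diff[OF dh[OF that] dhm[OF that]], of 2]
    unfolding Feq by (simp add: q_def algebra_simps)
  have zG': "z * deriv G z = (q z - 1) * G z" if "z \<in> unit_disc" for z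
    using DERIV_unique[OF dF[OF that] DERIV_mult[OF DERIV_ident dG[OF that]]]
    by (simp add: algebra_simps)
  have dg: "(g has_field_derivative G z) (at z)" if "z \<in> unit_disc" for z
  proof -
    have 1: "(f has_field_derivative deriv f z) (at z)"
      using holomorphic_derivI[OF f open_ball that] .
    have 2: "((\<lambda>z. f (- z)) has_field_derivative - deriv f (- z)) (at z)"
      using DERIV_chain2[OF holomorphic_derivI[OF f open_ball minus[OF that]] DERIV_minus[OF DERIV_ident]]
      by simp
    from DERIV_cdivide[OF DERIV_diff[OF 1 2], of 2] show ?thesis
      unfolding g_def[abs_def] G_def by simp
  qed
  have g0: "g 0 = 0" by (simp add: g_def)
  have dg0: "deriv g 0 = 1" using DERIV_imp_deriv[OF dg, of 0] G0 by simp
  define s where "s z = (if z = 0 then deriv g 0 else (g z - g 0) / (z - 0))" for z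
  have hols: "s holomorphic_on unit_disc"
    unfolding s_def by (rule pole_lemma_open[OF holg open_ball])
  have gs: "g z = z * s z" for z by (simp add: s_def g0)
  have s0: "s 0 = 1" by (simp add: s_def dg0)

  define u where "u z = s z / G z" for z
  have holu: "u holomorphic_on unit_disc" unfolding u_def
    by (intro holomorphic_intros hols holG Gnz)
  have u0: "u 0 = 1" by (simp add: u_def s0 G0)
  have gu: "g z = (z * G z) * u z" if "z \<in> unit_disc" for z
    using Gnz[OF that] by (simp add: gs u_def)
  have du: "(u has_field_derivative deriv u z) (at z)" if "z \<in> unit_disc" for z
    using holomorphic_derivI[OF holu open_ball that] .
  have ueq: "z * deriv u z + q z * u z = 1" if z: "z \<in> unit_disc" for z
  proof -
    have "(g has_field_derivative (z * G z) * deriv u z + q z * G z * u z) (at z)"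
      by (rule has_field_derivative_transform_within_open
            [OF DERIV_mult'[OF dF[OF z] du[OF z]] open_ball z]) (simp only: gu)
    from DERIV_unique[OF dg[OF z] this]
    have "G z * (z * deriv u z + q z * u z) = G z * 1" by (simp add: algebra_simps)
    then show ?thesis using Gnz[OF z] mult_left_cancel by blast
  qed
  have upos: "Re (u z) > 0" if z: "z \<in> unit_disc" for z
  proof (rule ccontr)
    assume "\<not> Re (u z) > 0"
    then obtain c where c: "c \<in> unit_disc" "Re (u c) = 0" "Im (c * deriv u c) = 0" "Re (c * deriv u c) \<le> 0"
      using first_zero_of_Re[OF holu _ z] u0 by (metis not_le one_complex.sel(1) zero_less_one)
    have "Im (c * deriv u c + q c * u c) = 0" "Re (c * deriv u c + q c * u c) = 1"
      unfolding ueq[OF c(1)] by simp_all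
    moreover have "Im (c * deriv u c + q c * u c) = Re (q c) * Im (u c)"
      "Re (c * deriv u c + q c * u c) = Re (c * deriv u c) - Im (q c) * Im (u c)"
      unfolding plus_complex.sel c(3) by (simp_all add: c(2))
    ultimately show False using qpos[OF c(1)] c(4) by simp
  qed
  have snz: "s z \<noteq> 0" if "z \<in> unit_disc" for z
    using upos[OF that] by (auto simp: u_def)

  define U where "U z = deriv f z / s z" for z
  have holU: "U holomorphic_on unit_disc" unfolding U_def
    by (intro holomorphic_intros holf' hols snz)
  have U0: "U 0 = 1" by (simp add: U_def f'0 s0)
  have hU: "h z = U z * g z" if "z \<in> unit_disc" for z
    using snz[OF that] by (simp add: h_def U_def gs)
  have Ueq: "U z + u z * (z * deriv U z) = p z" if z: "z \<in> unit_disc" for z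
  proof -
    have dU: "(U has_field_derivative deriv U z) (at z)"
      using holomorphic_derivI[OF holU open_ball z] .
    have "(h has_field_derivative U z * G z + deriv U z * g z) (at z)"
      by (rule has_field_derivative_transform_within_open
            [OF DERIV_mult'[OF dU dg[OF z]] open_ball z]) (simp only: hU)
    from DERIV_unique[OF dh[OF z] this]
    have "G z * (U z + u z * (z * deriv U z)) = G z * p z"
      by (simp add: gu[OF z] algebra_simps)
    then show ?thesis using Gnz[OF z] mult_left_cancel by blast
  qed
  have Upos: "Re (U z) > 0" if z: "z \<in> unit_disc" for z
  proof (rule ccontr)
    assume "\<not> Re (U z) > 0"
    then obtain c where c: "c \<in> unit_disc" "Re (U c) = 0" "Im (c * deriv U c) = 0" "Re (c * deriv U c) \<le> 0"
      using first_zero_of_Re[OF holU _ z] U0 by (metis not_le one_complex.sel(1) zero_less_one)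
    have "Re (p c) = Re (u c) * Re (c * deriv U c)"
      unfolding Ueq[OF c(1), symmetric] plus_complex.sel times_complex.sel(1)[of "u c"] c(2,3) by simp
    also have "\<dots> \<le> 0" using upos[OF c(1)] c(4) by (simp add: mult_nonneg_nonpos)
    finally show False using pos[OF c(1)] by simp
  qed

  have injh: "inj_on h unit_disc"
  proof (rule close_to_convex_imp_inj_on[OF holh holG Gnz])
    fix z :: complex assume z: "z \<in> unit_disc"
    show "Re (deriv (\<lambda>w. w * G w) z / G z) > 0"
      using qpos[OF z] Gnz[OF z] by (simp add: DERIV_imp_deriv[OF dF[OF z]])
    show "Re (deriv h z / G z) > 0"
      using pos[OF z] Gnz[OF z] by (simp add: dh'[OF z])
  qed
  have injf: "inj_on f unit_disc"
  proof (rule close_to_convex_imp_inj_on[OF f hols snz])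
    fix z :: complex assume z: "z \<in> unit_disc"
    have "(\<lambda>w. w * s w) = g" by (simp add: gs fun_eq_iff)
    then have "deriv (\<lambda>w. w * s w) z / s z = inverse (u z)"
      by (simp add: DERIV_imp_deriv[OF dg[OF z]] u_def)
    moreover have "Re (inverse (u z)) > 0"
      using upos[OF z] by (auto intro!: divide_pos_pos add_pos_nonneg)
    ultimately show "Re (deriv (\<lambda>w. w * s w) z / s z) > 0" by simp
    show "Re (deriv f z / s z) > 0" using Upos[OF z] by (simp add: U_def)
  qed

  \<comment> \<open>\<open>(1 - t) / (1 + t)\<close> bounds \<open>p\<close> and \<open>1 / (1 + t)\<^sup>2\<close> bounds \<open>G\<close>; the product has the primitive \<open>t / (1 + t)\<^sup>2\<close>.\<close>
  have h_ge: "cmod z / (1 + cmod z)\<^sup>2 \<le> cmod (h z)" if "z \<in> unit_disc" for z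
  proof (rule univalent_growth[where \<Lambda> = "\<lambda>t. t / (1 + t)\<^sup>2" and \<mu> = "\<lambda>t. (1 - t) / (1 + t) ^ 3",
        OF holh injh _ _ _ _ _ _ that])
    show "h 0 = 0" by (simp add: h_def)
    show "continuous_on {0..1::real} (\<lambda>t. t / (1 + t)\<^sup>2)"
      by (intro continuous_intros) auto
    show "((\<lambda>t. t / (1 + t)\<^sup>2) has_real_derivative (1 - t) / (1 + t) ^ 3) (at t)" if "0 < t" for t :: real
      using that by (auto intro!: derivative_eq_intros simp: divide_simps power2_eq_square power3_eq_cube)
        (auto simp: algebra_simps)
    fix z :: complex assume z: "z \<in> unit_disc"
    have "(1 - cmod z) / (1 + cmod z) ^ 3 = (1 - cmod z) / (1 + cmod z) * (1 / (1 + cmod z)\<^sup>2)"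
      by (simp add: power2_eq_square power3_eq_cube)
    also have "\<dots> \<le> cmod (p z) * cmod (G z)"
    proof (rule mult_mono)
      show "(1 - cmod z) / (1 + cmod z) \<le> cmod (p z)"
        using caratheodory_Re_lower_bound[OF p p0 pos z] complex_Re_le_cmod[of "p z"] by linarith
      show "1 / (1 + cmod z)\<^sup>2 \<le> cmod (G z)"
        by (rule log_derivative_lower_bound[OF holG G0 Gnz holq q0 qpos zG' z])
    qed auto
    finally show "(1 - cmod z) / (1 + cmod z) ^ 3 \<le> cmod (deriv h z)"
      by (simp add: dh'[OF z] norm_mult)
  qed auto
  have "(\<lambda>t::real. t / (1 + t)) 1 \<le> infdist 0 (frontier (f ` unit_disc))"
  proof (rule univalent_covering[where \<Lambda> = "\<lambda>t. t / (1 + t)" and \<mu> = "\<lambda>t. 1 / (1 + t)\<^sup>2",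
        OF f injf f0])
    show "continuous_on {0..1::real} (\<lambda>t. t / (1 + t))"
      by (intro continuous_intros) auto
    show "((\<lambda>t. t / (1 + t)) has_real_derivative 1 / (1 + t)\<^sup>2) (at t)" if "0 < t" for t :: real
      using that by (auto intro!: derivative_eq_intros simp: divide_simps power2_eq_square)
    fix z :: complex assume z: "z \<in> unit_disc"
    show "1 / (1 + cmod z)\<^sup>2 \<le> cmod (deriv f z)"
    proof (cases "z = 0")
      case True
      then show ?thesis by (simp add: f'0)
    next
      case False
      have "cmod z * (1 / (1 + cmod z)\<^sup>2) \<le> cmod z * cmod (deriv f z)"
        using h_ge[OF z] by (simp add: h_def norm_mult)
      then show ?thesis using False by (metis mult_left_le_imp_le zero_less_norm_iff)
    qed
  qed auto
  then show ?thesis by simp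
qed

section \<open>Majorants and averaged integrals\<close>

lemma integrable_on_continuous_bounded:
  fixes f :: "real \<Rightarrow> real"
  assumes cont: "continuous_on {a<..<b} f" and bound: "\<And>x. a < x \<Longrightarrow> x < b \<Longrightarrow> \<bar>f x\<bar> \<le> B"
  shows "f integrable_on {a..b}"
proof -
  have "f absolutely_integrable_on {a<..<b}"
  proof (rule measurable_bounded_by_integrable_imp_absolutely_integrable)
    show "f \<in> borel_measurable (lebesgue_on {a<..<b})"
      by (rule continuous_imp_measurable_on_sets_lebesgue[OF cont]) simp
    show "(\<lambda>x. B) integrable_on {a<..<b}"
      unfolding integrable_on_Icc_iff_Ioo[symmetric] by (rule integrable_const_ivl)
  qed (use bound in auto)
  then show ?thesis
    using absolutely_integrable_on_def integrable_on_Icc_iff_Ioo by blast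
qed

text \<open>
  Both \<open>R_s\<close> and \<open>L_s\<close> are integrals of the means \<open>1 / s * integral {0..s} m\<close>. A linear lower bound
  \<open>\<alpha> + \<beta> * t\<close> for \<open>m\<close> becomes \<open>\<alpha> + \<beta> * s / 2\<close> for its means. The bounds are required on the half-open interval only,
  because for \<open>L_s\<close> at \<open>r = 1\<close> the integrand is meaningful only there; the value of the mean at \<open>s = 0\<close>, a
  division by zero, does not influence the integral.
\<close>

lemma averaged_integral:
  fixes m :: "real \<Rightarrow> real"
  assumes r: "0 < r" and cont: "continuous_on {0..<r} m"
    and lower: "\<And>t. 0 \<le> t \<Longrightarrow> t < r \<Longrightarrow> \<alpha> + \<beta> * t \<le> m t"
    and upper: "\<And>t. 0 \<le> t \<Longrightarrow> t < r \<Longrightarrow> m t \<le> B"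
  shows averaged_integrable: "(\<lambda>s. 1 / s * integral {0..s} m) integrable_on {0..r}"
    and averaged_lower: "\<alpha> * r + \<beta> * r\<^sup>2 / 4 \<le> integral {0..r} (\<lambda>s. 1 / s * integral {0..s} m)"
    and averaged_upper: "integral {0..r} (\<lambda>s. 1 / s * integral {0..s} m) \<le> B * r"
proof -
  have linear: "((\<lambda>t. a + b * t) has_integral a * s + b * s\<^sup>2 / 2) {0..s}" if "0 \<le> s" for a b s :: real
  proof -
    have "((\<lambda>t. a + b * t) has_integral (a * s + b * s\<^sup>2 / 2) - (a * 0 + b * 0\<^sup>2 / 2)) {0..s}"
    proof (rule fundamental_theorem_of_calculus[OF that])
      fix x :: real
      have "((\<lambda>t. a * t + b * t\<^sup>2 / 2) has_real_derivative a + b * x) (at x within {0..s})"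
        by (auto intro!: derivative_eq_intros)
      then show "((\<lambda>t. a * t + b * t\<^sup>2 / 2) has_vector_derivative a + b * x) (at x within {0..s})"
        by (simp add: has_real_derivative_iff_has_vector_derivative)
    qed
    then show ?thesis by simp
  qed
  define C where "C = \<bar>B\<bar> + \<bar>\<alpha>\<bar> + \<bar>\<beta>\<bar> * r"
  have m_bound: "\<bar>m t\<bar> \<le> C" if "0 < t" "t < r" for t
  proof -
    have "\<bar>\<beta> * t\<bar> \<le> \<bar>\<beta>\<bar> * r" using that by (simp add: abs_mult mult_left_mono)
    then show ?thesis using lower[of t] upper[of t] that unfolding C_def by linarith
  qed
  have int: "m integrable_on {0..r}"
    by (rule integrable_on_continuous_bounded[OF continuous_on_subset[OF cont] m_bound]) auto
  have ints: "m integrable_on {0..s}" if "0 < s" "s < r" for s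
    by (rule integrable_on_subinterval[OF int]) (use that in auto)
  have bounds: "\<alpha> + \<beta> / 2 * s \<le> 1 / s * integral {0..s} m" "1 / s * integral {0..s} m \<le> B + 0 * s"
    if s: "0 < s" "s < r" for s
  proof -
    have "\<alpha> * s + \<beta> * s\<^sup>2 / 2 \<le> integral {0..s} m"
      using s by (intro has_integral_le[OF linear integrable_integral[OF ints[OF s]]] lower) auto
    then have "(\<alpha> + \<beta> / 2 * s) * s \<le> integral {0..s} m"
      by (simp add: power2_eq_square algebra_simps)
    then show "\<alpha> + \<beta> / 2 * s \<le> 1 / s * integral {0..s} m"
      using s by (simp add: pos_le_divide_eq)
    have "integral {0..s} m \<le> B * s + 0 * s\<^sup>2 / 2"
      using s by (intro has_integral_le[OF integrable_integral[OF ints[OF s]] linear]) (auto intro: upper)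
    then show "1 / s * integral {0..s} m \<le> B + 0 * s"
      using s by (simp add: pos_divide_le_eq)
  qed
  define D where "D = \<bar>B\<bar> + \<bar>\<alpha>\<bar> + \<bar>\<beta> / 2\<bar> * r"
  show avg: "(\<lambda>s. 1 / s * integral {0..s} m) integrable_on {0..r}"
  proof (rule integrable_on_continuous_bounded)
    have "continuous_on {0<..<r} (\<lambda>s. integral {0..s} m)"
      by (rule continuous_on_subset[OF indefinite_integral_continuous_1[OF int]]) auto
    then show "continuous_on {0<..<r} (\<lambda>s. 1 / s * integral {0..s} m)"
      by (intro continuous_intros) auto
    fix s assume s: "0 < s" "s < r"
    have "\<bar>\<beta> / 2 * s\<bar> \<le> \<bar>\<beta> / 2\<bar> * r" unfolding abs_mult using s by (intro mult_left_mono) auto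
    then show "\<bar>1 / s * integral {0..s} m\<bar> \<le> D" using bounds[OF s] unfolding D_def by linarith
  qed
  then have avg': "((\<lambda>s. 1 / s * integral {0..s} m) has_integral
      integral {0..r} (\<lambda>s. 1 / s * integral {0..s} m)) {0<..<r}"
    unfolding has_integral_Icc_iff_Ioo[symmetric] by (rule integrable_integral)
  have "\<alpha> * r + \<beta> / 2 * r\<^sup>2 / 2 \<le> integral {0..r} (\<lambda>s. 1 / s * integral {0..s} m)"
    by (rule has_integral_le[OF linear[unfolded has_integral_Icc_iff_Ioo] avg']) (use r bounds in auto)
  then show "\<alpha> * r + \<beta> * r\<^sup>2 / 4 \<le> integral {0..r} (\<lambda>s. 1 / s * integral {0..s} m)"
    by simp
  have "integral {0..r} (\<lambda>s. 1 / s * integral {0..s} m) \<le> B * r + 0 * r\<^sup>2 / 2"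
    by (rule has_integral_le[OF avg' linear[unfolded has_integral_Icc_iff_Ioo]]) (use r bounds in auto)
  then show "integral {0..r} (\<lambda>s. 1 / s * integral {0..s} m) \<le> B * r" by simp
qed

lemma summable_majorant:
  assumes f: "f holomorphic_on unit_disc" and r: "0 \<le> r" "r < 1"
  shows "summable (\<lambda>n. cmod (taylor_coeff f n) * r ^ n)"
proof -
  have "f holomorphic_on eball 0 (ereal 1)" using f by simp
  from conv_radius_fps_expansion[OF this]
  have "ereal 1 \<le> conv_radius (fps_nth (fps_expansion f 0))" by (simp add: fps_conv_radius_def)
  moreover have "ereal (norm (of_real r :: complex)) < ereal 1" using r by simp
  ultimately have "ereal (norm (of_real r :: complex)) < conv_radius (fps_nth (fps_expansion f 0))"
    by (rule less_le_trans[rotated])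
  from abs_summable_in_conv_radius[OF this] show ?thesis
    using r by (simp add: norm_mult norm_power)
qed

lemma continuous_on_majorant:
  assumes f: "f holomorphic_on unit_disc"
  shows "continuous_on {0..<1} (majorant f)"
proof (intro continuous_at_imp_continuous_on ballI)
  fix t :: real assume t: "t \<in> {0..<1}"
  show "isCont (majorant f) t"
    unfolding majorant_def
    by (rule isCont_powser[where K = "(t + 1) / 2"]) (use t summable_majorant[OF f] in auto)
qed

lemma majorant_ge:
  assumes f: "f holomorphic_on unit_disc" and r: "0 \<le> r" "r < 1"
  shows "cmod (f 0) + cmod (deriv f 0) * r \<le> majorant f r"
proof -
  have "(\<Sum>n\<in>{0, 1}. cmod (taylor_coeff f n) * r ^ n) \<le> majorant f r"
    unfolding majorant_def
    by (rule sum_le_suminf[OF summable_majorant[OF f r]]) (use r in auto)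
  then show ?thesis by (simp add: fps_expansion_def)
qed

section \<open>The Bohr inequality and the smallest root\<close>

text \<open>
  The Bohr inequality on the whole disc of radius \<open>1 / 3\<close>: with all coefficients at most 1 the left-hand side is at most
  \<open>1 / 3 + (1 / 9) / (1 - 1 / 3) = 1 / 2\<close>, and \<open>1 / 2\<close> is the covering radius.
\<close>

lemma class_C_s_bohr:
  assumes \<phi>: "\<phi> holomorphic_on unit_disc" "\<phi> 0 = 1" "\<And>z. z \<in> unit_disc \<Longrightarrow> Re (\<phi> z) > 0"
    and f: "f \<in> class_C_s \<phi>" and z: "cmod z \<le> 1 / 3"
  shows "cmod z + (\<Sum>n. cmod (taylor_coeff f (n + 2)) * cmod z ^ (n + 2))
           \<le> infdist (f 0) (frontier (f ` unit_disc))"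
proof -
  have holf: "f holomorphic_on unit_disc" and f0: "f 0 = 0" and f'0: "deriv f 0 = 1"
    using f by (auto simp: class_C_s_def class_A_def)
  obtain \<omega> where \<omega>: "\<omega> holomorphic_on unit_disc" "\<omega> ` unit_disc \<subseteq> unit_disc" "\<omega> 0 = 0"
    and sub: "\<And>z. z \<in> unit_disc \<Longrightarrow>
        2 * deriv (\<lambda>w. w * deriv f w) z / (deriv f z + deriv f (- z)) = \<phi> (\<omega> z)"
    using f by (auto simp: class_C_s_def subordinate_def simp del: mem_ball)
  define p where "p z = \<phi> (\<omega> z)" for z
  have holp: "p holomorphic_on unit_disc"
    using holomorphic_on_compose_gen[OF \<omega>(1) \<phi>(1) \<omega>(2)] by (simp add: p_def[abs_def] o_def)
  have p0: "p 0 = 1" by (simp add: p_def \<omega> \<phi>)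
  have pos: "Re (p w) > 0" if "w \<in> unit_disc" for w
    unfolding p_def by (rule \<phi>(3)) (use \<omega>(2) that in blast)
  have den: "deriv f w + deriv f (- w) \<noteq> 0" if "w \<in> unit_disc" for w
  proof
    assume "deriv f w + deriv f (- w) = 0"
    then have "p w = 0" using sub[OF that] by (simp add: p_def)
    then show False using pos[OF that] by simp
  qed
  have eq: "2 * deriv (\<lambda>w. w * deriv f w) w = p w * (deriv f w + deriv f (- w))"
    if "w \<in> unit_disc" for w
    using sub[OF that] den[OF that] by (simp add: p_def divide_eq_eq)
  have coeff: "cmod (taylor_coeff f (n + 2)) \<le> 1" for n
    using coeff_bound_wrt_symmetric_points[OF holf f'0 holp p0 pos eq, of "Suc n"] by simp
  define r where "r = cmod z"
  have r: "0 \<le> r" "r \<le> 1 / 3" using z by (auto simp: r_def)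
  have geo: "(\<lambda>n. r\<^sup>2 * r ^ n) sums (r\<^sup>2 * (1 / (1 - r)))"
    using r by (intro sums_mult geometric_sums) simp
  have le: "cmod (taylor_coeff f (n + 2)) * r ^ (n + 2) \<le> r\<^sup>2 * r ^ n" for n
    using mult_right_mono[OF coeff[of n], of "r ^ (n + 2)"] r by (simp add: power_add mult.commute power2_eq_square)
  have "summable (\<lambda>n. cmod (taylor_coeff f (n + 2)) * r ^ (n + 2))"
    using summable_majorant[OF holf r(1)] r(2) summable_iff_shift[of "\<lambda>n. cmod (taylor_coeff f n) * r ^ n" 2]
    by simp
  then have "(\<Sum>n. cmod (taylor_coeff f (n + 2)) * r ^ (n + 2)) \<le> r\<^sup>2 * (1 / (1 - r))"
    using suminf_le[OF le _ sums_summable[OF geo]] sums_unique[OF geo] by simp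
  also have "\<dots> \<le> (1 / 3) * (1 / 3) * (1 / (1 - 1 / 3))"
    unfolding power2_eq_square using r by (intro mult_mono frac_le) auto
  finally have "r + (\<Sum>n. cmod (taylor_coeff f (n + 2)) * r ^ (n + 2)) \<le> 1 / 2"
    using r by simp
  also have "\<dots> \<le> infdist 0 (frontier (f ` unit_disc))"
    by (rule covering_wrt_symmetric_points[OF holf f0 f'0 holp p0 pos den eq])
  finally show ?thesis by (simp add: r_def f0)
qed

text \<open>
  The maximum modulus principle for \<open>1 / \<phi>\<close>.
\<close>

lemma min_modulus_le_one:
  assumes \<phi>: "\<phi> holomorphic_on unit_disc" "\<phi> 0 = 1" "\<And>z. z \<in> unit_disc \<Longrightarrow> \<phi> z \<noteq> 0"
    and r: "0 < r" "r < 1"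
  shows "(INF z\<in>sphere 0 r. cmod (\<phi> z)) \<le> 1"
proof (rule ccontr)
  define v where "v = (INF z\<in>sphere 0 r. cmod (\<phi> z))"
  assume "\<not> ?thesis"
  then have v: "v > 1" by (simp add: v_def)
  have sub: "cball 0 r \<subseteq> unit_disc" using r by auto
  have hol: "(\<lambda>z. 1 / \<phi> z) holomorphic_on unit_disc" by (intro holomorphic_intros \<phi>)
  have "cmod (1 / \<phi> 0) \<le> 1 / v"
  proof (rule maximum_modulus_frontier[of "\<lambda>z. 1 / \<phi> z" "cball 0 r"])
    show "(\<lambda>z. 1 / \<phi> z) holomorphic_on interior (cball 0 r)"
      by (rule holomorphic_on_subset[OF hol]) (use sub interior_subset in blast)
    show "continuous_on (closure (cball 0 r)) (\<lambda>z. 1 / \<phi> z)"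
      using holomorphic_on_imp_continuous_on[OF holomorphic_on_subset[OF hol sub]] by simp
    fix z :: complex assume "z \<in> frontier (cball 0 r)"
    then have z: "z \<in> sphere 0 r" using r by (simp only: frontier_cball)
    have "bdd_below ((\<lambda>z. cmod (\<phi> z)) ` sphere 0 r)" by (rule bdd_belowI[of _ 0]) auto
    then have "v \<le> cmod (\<phi> z)" unfolding v_def using z by (rule cINF_lower)
    then show "cmod (1 / \<phi> z) \<le> 1 / v" using v by (simp add: norm_divide frac_le)
  qed (use r in auto)
  then show False using v \<phi>(2) by simp
qed

text \<open>
  At \<open>- t\<^sup>2\<close> the square root of \<open>k'\<close> is at least \<open>1 / (1 + t\<^sup>2)\<close>, and \<open>\<phi> (- t) \<ge> (1 - t) / (1 + t)\<close>. The product of these two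
  is at least \<open>1 - 2 * t\<close>, whose averaged integral over the unit interval is \<open>1 / 2\<close>.
\<close>

lemma L_s_bounds:
  assumes \<phi>: "\<phi> holomorphic_on unit_disc" "\<phi> 0 = 1" "\<And>z. z \<in> unit_disc \<Longrightarrow> Re (\<phi> z) > 0"
    and neg: "\<And>t::real. 0 < t \<Longrightarrow> t < 1 \<Longrightarrow> Im (\<phi> (- of_real t)) = 0"
      "\<And>t::real. 0 < t \<Longrightarrow> t < 1 \<Longrightarrow> Re (\<phi> (- of_real t)) \<le> 1"
    and k: "deriv k holomorphic_on unit_disc" "deriv k 0 = 1"
      "\<And>z. z \<in> unit_disc \<Longrightarrow> deriv k z \<noteq> 0"
      "\<And>z. z \<in> unit_disc \<Longrightarrow> z * deriv (deriv k) z = (\<phi> z - 1) * deriv k z"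
  shows "1 / 2 \<le> L_s k \<phi> 1" and "L_s k \<phi> 1 \<le> 1"
proof -
  define m where "m t = sqrt (Re (deriv k (of_real (- (t\<^sup>2))))) * Re (\<phi> (of_real (- t)))" for t
  have sq1: "t\<^sup>2 < 1" if "0 \<le> t" "t < 1" for t :: real
    using that by (simp add: power_less_one_iff)
  have cont: "continuous_on {0..<1} m"
    unfolding m_def
  proof (intro continuous_intros)
    show "continuous_on {0..<1} (\<lambda>t. deriv k (of_real (- (t\<^sup>2))))"
      by (rule continuous_on_compose2[OF holomorphic_on_imp_continuous_on[OF k(1)]])
         (auto intro!: continuous_intros simp: norm_power power_less_one_iff)
    show "continuous_on {0..<1} (\<lambda>t. \<phi> (of_real (- t)))"
      by (rule continuous_on_compose2[OF holomorphic_on_imp_continuous_on[OF \<phi>(1)]])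
         (auto intro!: continuous_intros)
  qed
  have bounds: "1 + (- 2) * t \<le> m t" "m t \<le> 1" if t: "0 \<le> t" "t < 1" for t
  proof -
    have tD: "- of_real t \<in> unit_disc" "- of_real (t\<^sup>2) \<in> unit_disc"
      using t sq1[OF t] by (simp_all add: norm_power)
    have t2: "0 \<le> t\<^sup>2" "t\<^sup>2 < 1" using sq1[OF t] by simp_all
    note neg_axis = solution_on_negative_axis[OF k(1,2,3,4) neg t2]
    have k_low: "(1 / (1 + t\<^sup>2))\<^sup>2 \<le> Re (deriv k (- of_real (t\<^sup>2)))"
      using log_derivative_lower_bound[OF k(1,2,3) \<phi> k(4) tD(2)] neg_axis(1)
      by (simp add: power_divide norm_power)
    have \<phi>_low: "(1 - t) / (1 + t) \<le> Re (\<phi> (- of_real t))"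
      using caratheodory_Re_lower_bound[OF \<phi> tD(1)] t by simp
    have \<phi>_up: "Re (\<phi> (- of_real t)) \<le> 1"
      using neg(2)[of t] t \<phi>(2) by (cases "t = 0") auto
    have k_nonneg: "0 \<le> Re (deriv k (- of_real (t\<^sup>2)))" using neg_axis(1) norm_ge_zero by metis
    have sqrt_low: "1 / (1 + t\<^sup>2) \<le> sqrt (Re (deriv k (- of_real (t\<^sup>2))))"
      by (rule real_le_rsqrt[OF k_low])
    have sqrt_up: "sqrt (Re (deriv k (- of_real (t\<^sup>2)))) \<le> 1"
      using neg_axis by (simp add: real_le_lsqrt)
    have m_eq: "m t = sqrt (Re (deriv k (- of_real (t\<^sup>2)))) * Re (\<phi> (- of_real t))"
      by (simp add: m_def)
    have "m t \<le> 1 * 1"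
      unfolding m_eq using \<phi>(3)[OF tD(1)]
      by (intro mult_mono sqrt_up \<phi>_up) (auto intro: less_imp_le)
    then show "m t \<le> 1" by simp
    have "(1 - 2 * t) * ((1 + t\<^sup>2) * (1 + t)) \<le> 1 - t"
    proof -
      have "(1 - t) - (1 - 2 * t) * ((1 + t\<^sup>2) * (1 + t)) = t\<^sup>2 + t ^ 3 + 2 * t ^ 4"
        by (simp add: algebra_simps power2_eq_square power3_eq_cube power4_eq_xxxx)
      moreover have "\<dots> \<ge> 0" using t by simp
      ultimately show ?thesis by linarith
    qed
    then have "1 - 2 * t \<le> (1 - t) / ((1 + t\<^sup>2) * (1 + t))"
      using t by (simp add: pos_le_divide_eq add_pos_nonneg)
    also have "\<dots> = 1 / (1 + t\<^sup>2) * ((1 - t) / (1 + t))" by simp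
    also have "\<dots> \<le> m t"
      unfolding m_eq using t k_nonneg by (intro mult_mono sqrt_low \<phi>_low) auto
    finally show "1 + (- 2) * t \<le> m t" by simp
  qed
  have L: "L_s k \<phi> 1 = integral {0..1} (\<lambda>s. 1 / s * integral {0..s} m)"
    by (simp add: L_s_def m_def[abs_def])
  show "1 / 2 \<le> L_s k \<phi> 1"
    using averaged_lower[OF _ cont bounds] unfolding L by simp
  show "L_s k \<phi> 1 \<le> 1"
    using averaged_upper[OF _ cont bounds] unfolding L by simp
qed

text \<open>
  The lower bound keeps the linear term of the majorant of \<open>\<phi>\<close>: without it \<open>R_s\<close> would only be seen to exceed values
  below 1.
\<close>

lemma R_s_properties:
  assumes K: "K' holomorphic_on unit_disc" "K' 0 = 1"
    and \<phi>: "\<phi> holomorphic_on unit_disc" "\<phi> 0 = 1" and r: "0 < r" "r < 1"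
  shows "continuous_on {0..r} (R_s K' \<phi>)"
    and "r + cmod (deriv \<phi> 0) * r\<^sup>2 / 4 \<le> R_s K' \<phi> r"
proof -
  define m where "m t = majorant K' t * majorant \<phi> t" for t
  have cont1: "continuous_on {0..<1} m"
    unfolding m_def by (intro continuous_intros continuous_on_majorant K \<phi>)
  have "compact (m ` {0..r})"
    by (intro compact_continuous_image continuous_on_subset[OF cont1]) (use r in auto)
  then have "bounded (m ` {0..r})" by (rule compact_imp_bounded)
  then obtain B where B: "\<And>t. t \<in> {0..r} \<Longrightarrow> \<bar>m t\<bar> \<le> B"
    unfolding bounded_iff by (metis image_eqI real_norm_def)
  have cont: "continuous_on {0..<r} m"
    by (rule continuous_on_subset[OF cont1]) (use r in auto)
  have lower: "1 + cmod (deriv \<phi> 0) * t \<le> m t" if "0 \<le> t" "t < r" for t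
  proof -
    have t: "0 \<le> t" "t < 1" using that r by auto
    have "1 * (1 + cmod (deriv \<phi> 0) * t) \<le> m t"
      unfolding m_def
    proof (rule mult_mono)
      have "1 + cmod (deriv K' 0) * t \<le> majorant K' t"
        using majorant_ge[OF K(1) t] by (simp add: K(2))
      moreover have "0 \<le> cmod (deriv K' 0) * t" using t by simp
      ultimately show "1 \<le> majorant K' t" "0 \<le> majorant K' t" by linarith+
      show "1 + cmod (deriv \<phi> 0) * t \<le> majorant \<phi> t"
        using majorant_ge[OF \<phi>(1) t] by (simp add: \<phi>(2))
    qed (use t in simp)
    then show ?thesis by simp
  qed
  have upper: "m t \<le> B" if "0 \<le> t" "t < r" for t
    using B[of t] that by simp
  have R: "R_s K' \<phi> = (\<lambda>r. integral {0..r} (\<lambda>s. 1 / s * integral {0..s} m))"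
    by (simp add: R_s_def[abs_def] m_def[abs_def])
  show "continuous_on {0..r} (R_s K' \<phi>)"
    unfolding R by (rule indefinite_integral_continuous_1[OF averaged_integrable[OF r(1) cont lower upper]])
  show "r + cmod (deriv \<phi> 0) * r\<^sup>2 / 4 \<le> R_s K' \<phi> r"
    using averaged_lower[OF r(1) cont lower upper] unfolding R by simp
qed

lemma smallest_root_exists:
  assumes K: "K' holomorphic_on unit_disc" "K' 0 = 1"
    and \<phi>: "\<phi> holomorphic_on unit_disc" "\<phi> 0 = 1" "deriv \<phi> 0 \<noteq> 0"
    and L: "0 < L" "L \<le> 1"
  shows "\<exists>\<rho>. 0 < \<rho> \<and> \<rho> < 1 \<and> R_s K' \<phi> \<rho> = L \<and>
           (\<forall>r. 0 < r \<and> r < 1 \<and> R_s K' \<phi> r = L \<longrightarrow> \<rho> \<le> r)"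
proof -
  define b where "b = cmod (deriv \<phi> 0)"
  have b: "b > 0" using \<phi>(3) by (simp add: b_def)
  \<comment> \<open>Chosen so that \<open>r1 + b * r1\<^sup>2 / 4 \<ge> 1\<close>: as \<open>r1 \<ge> 1 / 2\<close>, the second summand is at least \<open>b / 16\<close>.\<close>
  define r1 where "r1 = max (1 / 2) (1 - b / 32)"
  have r1: "1 / 2 \<le> r1" "0 < r1" "r1 < 1" "1 - b / 32 \<le> r1" using b by (auto simp: r1_def)
  note R = R_s_properties[OF K \<phi>(1,2) r1(2,3)]
  have "(1 / 2)\<^sup>2 \<le> r1\<^sup>2" using r1 by (intro power_mono) auto
  then have "b * (1 / 4) \<le> b * r1\<^sup>2" using b by (intro mult_left_mono) (auto simp: power2_eq_square)
  then have big: "L \<le> R_s K' \<phi> r1" using R(2) r1(4) b L(2) unfolding b_def[symmetric] by linarith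
  have R0: "R_s K' \<phi> 0 = 0" by (simp add: R_s_def)
  obtain x where x: "0 \<le> x" "x \<le> r1" "R_s K' \<phi> x = L"
    using IVT'[of "R_s K' \<phi>" 0 L r1] R0 L big r1 R(1) by auto
  \<comment> \<open>The least root in \<open>{0..r1}\<close> is the least root altogether.\<close>
  define S where "S = {0..r1} \<inter> R_s K' \<phi> -` {L}"
  have "closed S" unfolding S_def by (rule continuous_closed_preimage[OF R(1)]) auto
  moreover have "bounded S" unfolding S_def by (rule bounded_subset[OF bounded_closed_interval[of 0 r1]]) auto
  ultimately have "compact S" by (simp add: compact_eq_bounded_closed)
  moreover have "S \<noteq> {}" using x by (auto simp: S_def)
  ultimately obtain \<rho> where \<rho>: "\<rho> \<in> S" "\<And>r. r \<in> S \<Longrightarrow> \<rho> \<le> r"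
    using compact_attains_inf[of S] by blast
  have \<rho>': "0 \<le> \<rho>" "\<rho> \<le> r1" "R_s K' \<phi> \<rho> = L" using \<rho>(1) by (auto simp: S_def)
  have "\<rho> \<noteq> 0" using \<rho>'(3) R0 L by auto
  moreover have "\<rho> \<le> r" if "0 < r" "R_s K' \<phi> r = L" for r
    using \<rho>(2)[of r] that \<rho>'(2) by (cases "r \<le> r1") (auto simp: S_def)
  ultimately show ?thesis using \<rho>' r1 by (intro exI[of _ \<rho>]) auto
qed

theorem theorem2p25:
  fixes \<phi> k K f :: "complex \<Rightarrow> complex"
  assumes phi: "ma_minda \<phi>"
    and phi_min: "\<And>r::real. 0 < r \<Longrightarrow> r < 1 \<Longrightarrow>
          of_real (INF z\<in>sphere 0 r. cmod (\<phi> z)) = \<phi> (- of_real r)"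
    and phi_max: "\<And>r::real. 0 < r \<Longrightarrow> r < 1 \<Longrightarrow>
          of_real (SUP z\<in>sphere 0 r. cmod (\<phi> z)) = \<phi> (of_real r)"
    and k: "k holomorphic_on unit_disc" "k 0 = 0" "deriv k 0 = 1"
      "\<And>z. z \<in> unit_disc \<Longrightarrow> deriv k z \<noteq> 0 \<and> 1 + z * deriv (deriv k) z / deriv k z = \<phi> z"
    and K: "K holomorphic_on unit_disc" "deriv K 0 = 1"
      "\<And>z. z \<in> unit_disc \<Longrightarrow> (deriv K z)\<^sup>2 = deriv k (z\<^sup>2)"
    and f: "f \<in> class_C_s \<phi>"
  shows "\<exists>r_f::real. 0 < r_f \<and> r_f < 1 \<and> R_s (deriv K) \<phi> r_f = L_s k \<phi> 1 \<and>
           (\<forall>r. 0 < r \<and> r < 1 \<and> R_s (deriv K) \<phi> r = L_s k \<phi> 1 \<longrightarrow> r_f \<le> r) \<and>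
           (\<forall>z. cmod z \<le> min (1/3) r_f \<longrightarrow>
              cmod z + (\<Sum>n. cmod (taylor_coeff f (n + 2)) * cmod z ^ (n + 2))
                \<le> infdist (f 0) (frontier (f ` unit_disc)))"
proof -
  have \<phi>: "\<phi> holomorphic_on unit_disc" "\<phi> 0 = 1"
    and "\<phi> ` unit_disc \<subseteq> {w. Re w > 0}" and "deriv \<phi> 0 \<noteq> 0"
    using phi by (auto simp: ma_minda_def)
  then have pos: "Re (\<phi> z) > 0" if "z \<in> unit_disc" for z using that by blast
  have nz: "\<phi> z \<noteq> 0" if "z \<in> unit_disc" for z using pos[OF that] by auto
  have neg: "Im (\<phi> (- of_real t)) = 0" "Re (\<phi> (- of_real t)) \<le> 1" if "0 < t" "t < 1" for t :: real
    using phi_min[OF that, symmetric] min_modulus_le_one[OF \<phi> nz that] by simp_all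
  have k': "deriv k holomorphic_on unit_disc" "\<And>z. z \<in> unit_disc \<Longrightarrow> deriv k z \<noteq> 0"
    using k by (auto intro!: holomorphic_deriv)
  have k_eq: "z * deriv (deriv k) z = (\<phi> z - 1) * deriv k z" if "z \<in> unit_disc" for z
    using k(4)[OF that] by (auto simp: field_simps)
  note L = L_s_bounds[OF \<phi> pos neg k'(1) k(3) k'(2) k_eq]
  have "deriv K holomorphic_on unit_disc" using K(1) by (intro holomorphic_deriv) auto
  from smallest_root_exists[OF this K(2) \<phi> \<open>deriv \<phi> 0 \<noteq> 0\<close> _ L(2)] L(1)
  obtain \<rho> where "0 < \<rho>" "\<rho> < 1" "R_s (deriv K) \<phi> \<rho> = L_s k \<phi> 1"
    "\<forall>r. 0 < r \<and> r < 1 \<and> R_s (deriv K) \<phi> r = L_s k \<phi> 1 \<longrightarrow> \<rho> \<le> r"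
    by auto
  moreover have "cmod z + (\<Sum>n. cmod (taylor_coeff f (n + 2)) * cmod z ^ (n + 2))
      \<le> infdist (f 0) (frontier (f ` unit_disc))" if "cmod z \<le> min (1/3) \<rho>" for z
    using that by (intro class_C_s_bohr[OF \<phi> pos f]) auto
  ultimately show ?thesis by blast
qed

end
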